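(* For each $n \geq 2$ there exists a quadratic polynomial $f \in \mathbb{Z}[x]$ such that the arboreal Galois representation $G_f \hookrightarrow \mathrm{Aut}(T)$ attached to $f$ has the following properties: $G_f$ acts transitively on each level of $T$, $G_f$ contains an element acting as a $2^{n-1}$-cycle on level $n-1$ of $T$, and $G_f$ contains no element acting as a $2^n$-cycle on level $n$ of $T$.
   Context: $f^k$ denotes the $k$-th iterate (the $k$-fold composition) of $f$. For a quadratic $f \in \mathbb{Z}[x]$, let $T \subset \overline{\mathbb{Q}}$ be the set of all preimages of $0$ under all iterates of $f$. When $T$ does not contain a critical point of $f$, $T$ has a natural structure of a rooted tree with root $0$, the action of $f$ furnishing the connectivity relation (each vertex $\beta$ other than the root is joined to $f(\beta)$). The $k$-th level of $T$ is the set of vertices at distance $k$ from the root, and consists precisely of the roots of $f^k(x)$. The absolute Galois group $\mathrm{Gal}(\overline{\mathbb{Q}}/\mathbb{Q})$ acts on $T$ by tree automorphisms, preserving each level; the arboreal Galois representation $G_f$ is given by this action, i.e. $G_f$ is the Galois group of the extension of $\mathbb{Q}$ obtained by adjoining all elements of $T$, regarded as a subgroup of $\mathrm{Aut}(T)$, the group of automorphisms of the rooted tree $T$. *)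

theory Defs
  imports
    "HOL-Algebra.Bij"
    "HOL-Algebra.QuotRing"
    "HOL-Algebra.Generated_Fields"
    "HOL-Algebra.Algebraic_Closure_Type"
    "HOL-Combinatorics.Cycles"
    "HOL-Computational_Algebra.Polynomial"
begin

text \<open>
  We take the algebraic closure of the rationals inside \<^typ>\<open>complex\<close>. Every complex root of an
  iterate of a nonconstant integer polynomial is algebraic, so no preimages are gained or lost.
\<close>

abbreviation cpoly :: "int poly \<Rightarrow> complex poly" where
  "cpoly f \<equiv> map_poly of_int f"

definition preimage_level :: "int poly \<Rightarrow> nat \<Rightarrow> complex set" where
  "preimage_level f k = {z. (poly (cpoly f) ^^ k) z = 0}"

text \<open>
  These are the vertices at distance \<open>k\<close> from the root as soon as \<open>0\<close> is not periodic under \<open>f\<close>.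
  Periodicity of \<open>0\<close> is excluded whenever \<open>f\<close> is quadratic, the tree contains no critical point
  and the Galois action on every level is transitive: if \<open>0\<close> lies in level \<open>k > 0\<close>, then that level
  is \<open>{0}\<close>, although it has \<open>2 ^ k\<close> elements.
\<close>

definition preimage_tree :: "int poly \<Rightarrow> complex set" where
  "preimage_tree f = (\<Union>k. preimage_level f k)"

definition no_critical_point :: "int poly \<Rightarrow> bool" where
  "no_critical_point f \<longleftrightarrow> (\<forall>z \<in> preimage_tree f. poly (pderiv (cpoly f)) z \<noteq> 0)"

definition tree_edges :: "int poly \<Rightarrow> complex set set" where
  "tree_edges f = {{z, poly (cpoly f) z} | z. z \<in> preimage_tree f - {0}}"

definition tree_automorphisms :: "int poly \<Rightarrow> (complex \<Rightarrow> complex) set" where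
  "tree_automorphisms f = {\<pi> \<in> Bij (preimage_tree f). \<pi> 0 = 0 \<and>
     (\<forall>x \<in> preimage_tree f. \<forall>y \<in> preimage_tree f.
        {\<pi> x, \<pi> y} \<in> tree_edges f \<longleftrightarrow> {x, y} \<in> tree_edges f)}"

definition tree_aut_group :: "int poly \<Rightarrow> (complex \<Rightarrow> complex) monoid" where
  "tree_aut_group f = (BijGroup (preimage_tree f))\<lparr>carrier := tree_automorphisms f\<rparr>"

definition arboreal_field :: "int poly \<Rightarrow> complex ring" where
  "arboreal_field f = ring_of_type_algebra
     \<lparr>carrier := generate_field ring_of_type_algebra (\<rat> \<union> preimage_tree f)\<rparr>"

definition rat_galois_group :: "complex ring \<Rightarrow> (complex \<Rightarrow> complex) set" where
  "rat_galois_group K =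
     {\<sigma> \<in> extensional (carrier K). \<sigma> \<in> ring_iso K K \<and> (\<forall>q \<in> \<rat>. \<sigma> q = q)}"

text \<open>
  The Galois group regarded as a group of permutations of the tree. The lemmas
  \<open>arboreal_galois_subgroup\<close> and \<open>arboreal_galois_faithful\<close> below show that this is a
  subgroup of the automorphism group of the tree, and that no information is lost.
\<close>

definition arboreal_galois :: "int poly \<Rightarrow> (complex \<Rightarrow> complex) set" where
  "arboreal_galois f =
     (\<lambda>\<sigma>. restrict \<sigma> (preimage_tree f)) ` rat_galois_group (arboreal_field f)"

definition transitive_on :: "('a \<Rightarrow> 'a) set \<Rightarrow> 'a set \<Rightarrow> bool" where
  "transitive_on G S \<longleftrightarrow> (\<forall>x \<in> S. \<forall>y \<in> S. \<exists>\<pi> \<in> G. \<pi> x = y)"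

text \<open>
  The restriction of \<open>\<pi>\<close> to \<open>S\<close> is an \<open>m\<close>-cycle in the symmetric group of \<open>S\<close>; elements of \<open>S\<close>
  outside \<open>cs\<close> are fixed.
\<close>

definition acts_as_cycle :: "('a \<Rightarrow> 'a) \<Rightarrow> nat \<Rightarrow> 'a set \<Rightarrow> bool" where
  "acts_as_cycle \<pi> m S \<longleftrightarrow>
     (\<exists>cs. cycle cs \<and> length cs = m \<and> set cs \<subseteq> S \<and> (\<forall>x \<in> S. \<pi> x = cycle_of_list cs x))"


lemma generate_field_type_closed:
  fixes H :: "complex set"
  defines "K \<equiv> generate_field ring_of_type_algebra H"
  shows "1 \<in> K" and "h \<in> H \<Longrightarrow> h \<in> K"
    and "a \<in> K \<Longrightarrow> b \<in> K \<Longrightarrow> a + b \<in> K" and "a \<in> K \<Longrightarrow> b \<in> K \<Longrightarrow> a * b \<in> K"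
  using generate_field.intros[where R = "ring_of_type_algebra :: complex ring" and H = H]
  unfolding K_def by (simp_all add: ring_of_type_algebra_def)

lemma arboreal_field_simps [simp]:
  "monoid.mult (arboreal_field f) = (*)" "ring.add (arboreal_field f) = (+)"
  "monoid.one (arboreal_field f) = 1" "ring.zero (arboreal_field f) = 0"
  by (simp_all add: arboreal_field_def ring_of_type_algebra_def)

lemma arboreal_field_incl:
  "q \<in> \<rat> \<Longrightarrow> q \<in> carrier (arboreal_field f)"
  "z \<in> preimage_tree f \<Longrightarrow> z \<in> carrier (arboreal_field f)"
  by (auto simp: arboreal_field_def intro: generate_field.incl)

lemma arboreal_field_closed:
  assumes "a \<in> carrier (arboreal_field f)" "b \<in> carrier (arboreal_field f)"
  shows "a + b \<in> carrier (arboreal_field f)" "a * b \<in> carrier (arboreal_field f)"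
  using assms by (auto simp: arboreal_field_def intro: generate_field_type_closed)

lemma rat_galois_groupD:
  assumes "\<sigma> \<in> rat_galois_group (arboreal_field f)"
  defines "K \<equiv> carrier (arboreal_field f)"
  shows "bij_betw \<sigma> K K" and "q \<in> \<rat> \<Longrightarrow> \<sigma> q = q" and "\<sigma> \<in> extensional K"
    and "a \<in> K \<Longrightarrow> b \<in> K \<Longrightarrow> \<sigma> (a + b) = \<sigma> a + \<sigma> b"
    and "a \<in> K \<Longrightarrow> b \<in> K \<Longrightarrow> \<sigma> (a * b) = \<sigma> a * \<sigma> b"
  using assms unfolding rat_galois_group_def ring_iso_def ring_hom_def by auto

lemma poly_of_int_in_field:
  assumes "z \<in> carrier (arboreal_field f)"
  shows "poly (cpoly g) z \<in> carrier (arboreal_field f)"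
proof (induction g)
  case 0
  show ?case by (simp add: arboreal_field_incl(1))
next
  case (pCons a p)
  then show ?case
    using arboreal_field_closed arboreal_field_incl(1)[of "of_int a" f] assms
    by (simp add: map_poly_pCons)
qed

lemma galois_poly:
  assumes s: "\<sigma> \<in> rat_galois_group (arboreal_field f)" and z: "z \<in> carrier (arboreal_field f)"
  shows "\<sigma> (poly (cpoly g) z) = poly (cpoly g) (\<sigma> z)"
proof (induction g)
  case 0
  show ?case using rat_galois_groupD(2)[OF s] by simp
next
  case (pCons a p)
  have 1: "poly (cpoly p) z \<in> carrier (arboreal_field f)" by (rule poly_of_int_in_field[OF z])
  have 2: "of_int a \<in> carrier (arboreal_field f)" by (intro arboreal_field_incl) auto
  show ?case
    using pCons rat_galois_groupD[OF s] 1 2 z arboreal_field_closed[OF z 1]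
    by (simp add: map_poly_pCons)
qed

lemma galois_mem_field:
  assumes "\<sigma> \<in> rat_galois_group (arboreal_field f)" "z \<in> carrier (arboreal_field f)"
  shows "\<sigma> z \<in> carrier (arboreal_field f)"
  using rat_galois_groupD(1)[OF assms(1)] assms(2) by (auto simp: bij_betw_def)

lemma iterate_in_field:
  assumes "z \<in> carrier (arboreal_field f)"
  shows "(poly (cpoly g) ^^ k) z \<in> carrier (arboreal_field f)"
  using assms by (induction k) (auto intro: poly_of_int_in_field)

lemma galois_iterate:
  assumes s: "\<sigma> \<in> rat_galois_group (arboreal_field f)" and z: "z \<in> carrier (arboreal_field f)"
  shows "\<sigma> ((poly (cpoly g) ^^ k) z) = (poly (cpoly g) ^^ k) (\<sigma> z)"
  by (induction k) (simp_all add: galois_poly[OF s] iterate_in_field[OF z])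

lemma galois_eq_0_iff:
  assumes s: "\<sigma> \<in> rat_galois_group (arboreal_field f)" and z: "z \<in> carrier (arboreal_field f)"
  shows "\<sigma> z = 0 \<longleftrightarrow> z = 0"
proof -
  have "\<sigma> 0 = 0" using rat_galois_groupD(2)[OF s] by simp
  moreover have "0 \<in> carrier (arboreal_field f)" by (intro arboreal_field_incl) auto
  ultimately show ?thesis
    using rat_galois_groupD(1)[OF s] z by (metis bij_betw_imp_inj_on inj_on_eq_iff)
qed

lemma galois_level_iff:
  assumes s: "\<sigma> \<in> rat_galois_group (arboreal_field f)" and z: "z \<in> carrier (arboreal_field f)"
  shows "\<sigma> z \<in> preimage_level f k \<longleftrightarrow> z \<in> preimage_level f k"
  unfolding preimage_level_def mem_Collect_eq galois_iterate[OF s z, symmetric]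
  by (rule galois_eq_0_iff[OF s iterate_in_field[OF z]])

lemma galois_tree_iff:
  assumes "\<sigma> \<in> rat_galois_group (arboreal_field f)" and "z \<in> carrier (arboreal_field f)"
  shows "\<sigma> z \<in> preimage_tree f \<longleftrightarrow> z \<in> preimage_tree f"
  using galois_level_iff[OF assms] by (auto simp: preimage_tree_def)

lemma zero_in_tree: "0 \<in> preimage_tree f"
  by (auto simp: preimage_tree_def preimage_level_def intro!: exI[of _ 0])

lemma poly_in_tree:
  assumes "z \<in> preimage_tree f" "z \<noteq> 0"
  shows "poly (cpoly f) z \<in> preimage_tree f"
proof -
  obtain k where k: "(poly (cpoly f) ^^ k) z = 0"
    using assms by (auto simp: preimage_tree_def preimage_level_def)
  with assms obtain j where "k = Suc j" by (cases k) auto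
  with k show ?thesis
    by (auto simp: preimage_tree_def preimage_level_def funpow_swap1 intro!: exI[of _ j])
qed

lemma galois_bij_tree:
  assumes s: "\<sigma> \<in> rat_galois_group (arboreal_field f)"
  shows "bij_betw \<sigma> (preimage_tree f) (preimage_tree f)"
proof (rule bij_betw_imageI)
  note b = rat_galois_groupD(1)[OF s]
  show "inj_on \<sigma> (preimage_tree f)"
    using b by (meson bij_betw_def inj_on_subset arboreal_field_incl(2) subsetI)
  show "\<sigma> ` preimage_tree f = preimage_tree f"
  proof (intro equalityI subsetI)
    fix y assume "y \<in> \<sigma> ` preimage_tree f"
    then show "y \<in> preimage_tree f" using galois_tree_iff[OF s] arboreal_field_incl(2) by blast
  next
    fix y assume y: "y \<in> preimage_tree f"
    then obtain z where "z \<in> carrier (arboreal_field f)" "y = \<sigma> z"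
      using b arboreal_field_incl(2) by (metis bij_betw_imp_surj_on imageE)
    with y show "y \<in> \<sigma> ` preimage_tree f" using galois_tree_iff[OF s] by blast
  qed
qed

lemma galois_edge:
  assumes s: "\<sigma> \<in> rat_galois_group (arboreal_field f)"
    and x: "x \<in> preimage_tree f" and y: "y \<in> preimage_tree f"
  shows "{\<sigma> x, \<sigma> y} \<in> tree_edges f \<longleftrightarrow> {x, y} \<in> tree_edges f"
proof -
  have edge: "{a, b} \<in> tree_edges f \<longleftrightarrow>
      (a \<in> preimage_tree f - {0} \<and> b = poly (cpoly f) a) \<or>
      (b \<in> preimage_tree f - {0} \<and> a = poly (cpoly f) b)" for a b
    by (auto simp: tree_edges_def doubleton_eq_iff)
  have half: "\<sigma> a \<in> preimage_tree f - {0} \<and> \<sigma> b = poly (cpoly f) (\<sigma> a) \<longleftrightarrow>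
      a \<in> preimage_tree f - {0} \<and> b = poly (cpoly f) a"
    if a: "a \<in> preimage_tree f" and b: "b \<in> preimage_tree f" for a b
  proof -
    note a' = arboreal_field_incl(2)[OF a]
    have "\<sigma> b = \<sigma> (poly (cpoly f) a) \<longleftrightarrow> b = poly (cpoly f) a"
      using rat_galois_groupD(1)[OF s] arboreal_field_incl(2)[OF b] poly_of_int_in_field[OF a']
      by (metis bij_betw_imp_inj_on inj_on_eq_iff)
    then show ?thesis
      using galois_tree_iff[OF s a'] galois_eq_0_iff[OF s a'] galois_poly[OF s a'] by auto
  qed
  show ?thesis unfolding edge using half[OF x y] half[OF y x] by blast
qed

lemma arboreal_galois_subset: "arboreal_galois f \<subseteq> tree_automorphisms f"
proof
  fix \<pi> assume "\<pi> \<in> arboreal_galois f"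
  then obtain \<sigma> where s: "\<sigma> \<in> rat_galois_group (arboreal_field f)"
    and p: "\<pi> = restrict \<sigma> (preimage_tree f)" by (auto simp: arboreal_galois_def)
  have "bij_betw \<pi> (preimage_tree f) (preimage_tree f)"
    unfolding p using galois_bij_tree[OF s] by (simp cong: bij_betw_cong)
  moreover have "\<pi> 0 = 0"
    unfolding p using zero_in_tree rat_galois_groupD(2)[OF s] by simp
  ultimately show "\<pi> \<in> tree_automorphisms f"
    unfolding tree_automorphisms_def Bij_def using galois_edge[OF s] by (simp add: p)
qed

lemma galois_comp:
  assumes s: "\<sigma> \<in> rat_galois_group (arboreal_field f)" and t: "\<tau> \<in> rat_galois_group (arboreal_field f)"
  shows "compose (carrier (arboreal_field f)) \<sigma> \<tau> \<in> rat_galois_group (arboreal_field f)"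
proof -
  let ?K = "carrier (arboreal_field f)"
  have "1 \<in> ?K" by (intro arboreal_field_incl) auto
  moreover have "bij_betw (compose ?K \<sigma> \<tau>) ?K ?K"
    using rat_galois_groupD(1)[OF s] rat_galois_groupD(1)[OF t] by (rule bij_betw_compose[rotated])
  ultimately show ?thesis
    unfolding rat_galois_group_def ring_iso_def ring_hom_def
    using rat_galois_groupD[OF s] rat_galois_groupD[OF t] arboreal_field_closed[where f = f]
      galois_mem_field[OF s] galois_mem_field[OF t] arboreal_field_incl(1)[where f = f]
    by (auto simp: compose_def)
qed

lemma galois_inv:
  assumes s: "\<sigma> \<in> rat_galois_group (arboreal_field f)"
  defines "K \<equiv> carrier (arboreal_field f)"
  shows "restrict (inv_into K \<sigma>) K \<in> rat_galois_group (arboreal_field f)"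
proof -
  note b = rat_galois_groupD(1)[OF s, folded K_def]
  let ?i = "inv_into K \<sigma>"
  have K1: "1 \<in> K" unfolding K_def by (intro arboreal_field_incl) auto
  have KQ: "q \<in> K" if "q \<in> \<rat>" for q using that unfolding K_def by (intro arboreal_field_incl) auto
  have mem: "?i a \<in> K" and r: "\<sigma> (?i a) = a" if "a \<in> K" for a
    using b that by (auto simp: bij_betw_def inv_into_into f_inv_into_f)
  have l: "?i (\<sigma> a) = a" if "a \<in> K" for a using b that by (auto simp: bij_betw_def)
  have q: "?i q = q" if "q \<in> \<rat>" for q using l[OF KQ[OF that]] rat_galois_groupD(2)[OF s that] by simp
  have cl: "a + b \<in> K" "a * b \<in> K" if "a \<in> K" "b \<in> K" for a b
    using that arboreal_field_closed unfolding K_def by auto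
  have hom: "?i (a + b) = ?i a + ?i b" "?i (a * b) = ?i a * ?i b" if ab: "a \<in> K" "b \<in> K" for a b
    using l[OF cl(1)[OF mem[OF ab(1)] mem[OF ab(2)]]] l[OF cl(2)[OF mem[OF ab(1)] mem[OF ab(2)]]]
      rat_galois_groupD(4,5)[OF s, folded K_def, OF mem[OF ab(1)] mem[OF ab(2)]] r[OF ab(1)] r[OF ab(2)]
    by simp_all
  have "bij_betw (restrict ?i K) K K" using b by (simp add: bij_betw_inv_into cong: bij_betw_cong)
  then show ?thesis
    unfolding rat_galois_group_def ring_iso_def ring_hom_def
    using K1 KQ mem q cl hom by (auto simp: K_def[symmetric])
qed

lemma tree_automorphisms_subgroup: "subgroup (tree_automorphisms f) (BijGroup (preimage_tree f))"
proof -
  interpret B: group "BijGroup (preimage_tree f)" by (rule group_BijGroup)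
  let ?T = "preimage_tree f"
  show ?thesis
  proof (rule B.subgroupI)
    show "tree_automorphisms f \<subseteq> carrier (BijGroup ?T)"
      by (auto simp: tree_automorphisms_def BijGroup_def)
    have "(\<lambda>x\<in>?T. x) \<in> tree_automorphisms f"
      using zero_in_tree by (auto simp: tree_automorphisms_def id_Bij)
    then show "tree_automorphisms f \<noteq> {}" by blast
  next
    fix a assume a: "a \<in> tree_automorphisms f"
    then have aB: "a \<in> Bij ?T" by (auto simp: tree_automorphisms_def)
    have i: "inv\<^bsub>BijGroup ?T\<^esub> a = (\<lambda>x\<in>?T. inv_into ?T a x)" by (rule inv_BijGroup[OF aB])
    have mem: "inv_into ?T a x \<in> ?T" and r: "a (inv_into ?T a x) = x" if "x \<in> ?T" for x
      using aB that by (auto simp: Bij_def bij_betw_def inv_into_into f_inv_into_f)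
    have a0: "a 0 = 0" using a by (auto simp: tree_automorphisms_def)
    then have "inv_into ?T a 0 = 0"
      using aB zero_in_tree[of f] by (metis Bij_def IntD2 bij_betw_inv_into_left mem_Collect_eq)
    then show "inv\<^bsub>BijGroup ?T\<^esub> a \<in> tree_automorphisms f"
      unfolding i using a mem r restrict_inv_into_Bij[OF aB] zero_in_tree[of f]
      by (auto simp: tree_automorphisms_def) (metis mem r)+
  next
    fix a b assume a: "a \<in> tree_automorphisms f" and b: "b \<in> tree_automorphisms f"
    then have aB: "a \<in> Bij ?T" and bB: "b \<in> Bij ?T" by (auto simp: tree_automorphisms_def)
    have "b x \<in> ?T" if "x \<in> ?T" for x using bB that by (auto simp: Bij_def bij_betw_def)
    then show "a \<otimes>\<^bsub>BijGroup ?T\<^esub> b \<in> tree_automorphisms f"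
      using a b aB bB compose_Bij[OF aB bB] zero_in_tree[of f]
      by (auto simp: tree_automorphisms_def BijGroup_def compose_def)
  qed
qed

lemma tree_aut_group_is_group: "group (tree_aut_group f)"
  unfolding tree_aut_group_def
  by (rule group.subgroup_imp_group[OF group_BijGroup tree_automorphisms_subgroup])

theorem arboreal_galois_subgroup: "subgroup (arboreal_galois f) (tree_aut_group f)"
proof -
  let ?T = "preimage_tree f" and ?K = "carrier (arboreal_field f)"
  interpret B: group "BijGroup ?T" by (rule group_BijGroup)
  have TB: "tree_automorphisms f \<subseteq> Bij ?T" by (auto simp: tree_automorphisms_def)
  have TK: "x \<in> ?K" if "x \<in> ?T" for x using arboreal_field_incl(2)[OF that] .
  have "subgroup (arboreal_galois f) (BijGroup ?T)"
  proof (rule B.subgroupI)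
    show "arboreal_galois f \<subseteq> carrier (BijGroup ?T)"
      using arboreal_galois_subset TB by (auto simp: BijGroup_def)
    have "(\<lambda>x\<in>?K. x) \<in> rat_galois_group (arboreal_field f)"
      using arboreal_field_closed[where f = f] arboreal_field_incl(1)[where f = f]
      by (auto simp: rat_galois_group_def ring_iso_def ring_hom_def bij_betw_id[unfolded id_def])
    then show "arboreal_galois f \<noteq> {}" by (auto simp: arboreal_galois_def)
  next
    fix a assume A: "a \<in> arboreal_galois f"
    then obtain \<sigma> where s: "\<sigma> \<in> rat_galois_group (arboreal_field f)" and a: "a = restrict \<sigma> ?T"
      by (auto simp: arboreal_galois_def)
    from A have aB: "a \<in> Bij ?T" using arboreal_galois_subset TB by blast
    have "inv_into ?T a x = inv_into ?K \<sigma> x" if x: "x \<in> ?T" for x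
    proof -
      have "inv_into ?T a x \<in> ?T" "a (inv_into ?T a x) = x"
        using aB x by (auto simp: Bij_def bij_betw_def inv_into_into f_inv_into_f)
      then show ?thesis
        using rat_galois_groupD(1)[OF s] TK by (metis a bij_betw_inv_into_left restrict_apply')
    qed
    then have "inv\<^bsub>BijGroup ?T\<^esub> a = restrict (restrict (inv_into ?K \<sigma>) ?K) ?T"
      using inv_BijGroup[OF aB] TK by (auto simp: restrict_def fun_eq_iff)
    then show "inv\<^bsub>BijGroup ?T\<^esub> a \<in> arboreal_galois f"
      unfolding arboreal_galois_def by (rule image_eqI[OF _ galois_inv[OF s]])
  next
    fix a b assume A: "a \<in> arboreal_galois f" and B: "b \<in> arboreal_galois f"
    then obtain \<sigma> \<tau> where s: "\<sigma> \<in> rat_galois_group (arboreal_field f)" and a: "a = restrict \<sigma> ?T"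
      and t: "\<tau> \<in> rat_galois_group (arboreal_field f)" and b: "b = restrict \<tau> ?T"
      by (auto simp: arboreal_galois_def)
    have aB: "a \<in> Bij ?T" and bB: "b \<in> Bij ?T" using A B arboreal_galois_subset TB by blast+
    have "\<tau> x \<in> ?T" if "x \<in> ?T" for x using galois_tree_iff[OF t TK[OF that]] that by simp
    then have "a \<otimes>\<^bsub>BijGroup ?T\<^esub> b = restrict (compose ?K \<sigma> \<tau>) ?T"
      using aB bB TK by (auto simp: BijGroup_def a b compose_def restrict_def fun_eq_iff)
    then show "a \<otimes>\<^bsub>BijGroup ?T\<^esub> b \<in> arboreal_galois f"
      using galois_comp[OF s t] by (auto simp: arboreal_galois_def)
  qed
  then show ?thesis
    unfolding tree_aut_group_def
    by (rule B.subgroup_incl[OF _ tree_automorphisms_subgroup arboreal_galois_subset])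
qed

theorem arboreal_galois_faithful:
  "inj_on (\<lambda>\<sigma>. restrict \<sigma> (preimage_tree f)) (rat_galois_group (arboreal_field f))"
proof (rule inj_onI)
  fix \<sigma> \<tau> assume s: "\<sigma> \<in> rat_galois_group (arboreal_field f)"
    and t: "\<tau> \<in> rat_galois_group (arboreal_field f)"
    and eq: "restrict \<sigma> (preimage_tree f) = restrict \<tau> (preimage_tree f)"
  let ?R = "ring_of_type_algebra :: complex ring" and ?H = "\<rat> \<union> preimage_tree f"
  let ?K = "carrier (arboreal_field f)"
  have K: "?K = generate_field ?R ?H" by (simp add: arboreal_field_def)
  interpret R: field ?R by (rule field_from_type_algebra)
  have carr: "carrier ?R = UNIV" by (simp add: ring_of_type_algebra_def)
  have neg: "\<ominus>\<^bsub>?R\<^esub> a = - a" for a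
    by (rule R.minus_equality) (auto simp: ring_of_type_algebra_def)
  have inv: "inv\<^bsub>?R\<^esub> a = inverse a" if "a \<noteq> 0" for a
    by (rule R.comm_inv_char) (use that in \<open>auto simp: ring_of_type_algebra_def\<close>)
  have "\<sigma> x = \<tau> x" if "x \<in> generate_field ?R ?H" for x
    using that
  proof induction
    case one
    show ?case using rat_galois_groupD(2)[OF s] rat_galois_groupD(2)[OF t]
      by (simp add: ring_of_type_algebra_def)
  next
    case (incl h)
    then show ?case
      using rat_galois_groupD(2)[OF s] rat_galois_groupD(2)[OF t] fun_cong[OF eq, of h] by auto
  next
    case (a_inv h)
    have m: "- 1 \<in> ?K" by (intro arboreal_field_incl) auto
    have "\<rho> (- h) = - \<rho> h" if r: "\<rho> \<in> rat_galois_group (arboreal_field f)" for \<rho>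
      using rat_galois_groupD(5)[OF r m, of h] rat_galois_groupD(2)[OF r, of "- 1"] a_inv.hyps K
      by simp
    from this[OF s] this[OF t] show ?case using a_inv.IH unfolding neg by simp
  next
    case (m_inv h)
    have h: "h \<noteq> 0" using m_inv.hyps by (simp add: ring_of_type_algebra_def)
    have hK: "h \<in> ?K" using m_inv.hyps K by simp
    have iK: "inverse h \<in> ?K"
      using generate_field.m_inv[OF m_inv.hyps] inv[OF h] K by simp
    have "\<rho> (inverse h) = inverse (\<rho> h)" if r: "\<rho> \<in> rat_galois_group (arboreal_field f)" for \<rho>
    proof -
      have "\<rho> h * \<rho> (inverse h) = 1"
        using rat_galois_groupD(5)[OF r hK iK] rat_galois_groupD(2)[OF r, of 1] h by simp
      then show ?thesis by (metis inverse_unique)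
    qed
    from this[OF s] this[OF t] show ?case using m_inv.IH unfolding inv[OF h] by simp
  next
    case (eng_add a b)
    then show ?case
      using rat_galois_groupD(4)[OF s, of a b] rat_galois_groupD(4)[OF t, of a b] K
      by (simp add: ring_of_type_algebra_def)
  next
    case (eng_mult a b)
    then show ?case
      using rat_galois_groupD(5)[OF s, of a b] rat_galois_groupD(5)[OF t, of a b] K
      by (simp add: ring_of_type_algebra_def)
  qed
  then show "\<sigma> = \<tau>"
    using rat_galois_groupD(3)[OF s] rat_galois_groupD(3)[OF t] K by (metis extensionalityI)
qed

end

theory Submission
  imports Defs "HOL-Computational_Algebra.Polynomial_Factorial"
begin

text \<open>
  For \<open>f = (x - g)^2 + c\<close> the obstruction to long cycles is carried by one number per level. Call
  \<open>level_disc k\<close> the product of \<open>y - c\<close> over the vertices \<open>y\<close> of level \<open>k\<close>; up to the sign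
  \<open>(-1)^(2^k)\<close> it is the value at the critical point \<open>g\<close> of the iterate of order \<open>k + 1\<close>, hence an
  integer. Suppose that \<open>\<sigma>\<close> permutes level \<open>k\<close> in a single cycle of length \<open>N = 2^k\<close>, and let \<open>x\<close>
  lie above it. Then \<open>R = \<Prod>i<N. \<sigma>^i x - g\<close> is a square root of \<open>level_disc k\<close>, and comparing \<open>\<sigma> R\<close>
  with \<open>R\<close> shows that \<open>\<sigma>^N\<close> fixes \<open>x\<close> if \<open>\<sigma> R = R\<close> and exchanges \<open>x\<close> with its sibling
  \<open>2 g - x\<close> if \<open>\<sigma> R = - R\<close> (\<open>sqrt_disc_monodromy\<close>). So \<open>\<sigma>\<close> is a full cycle on level \<open>n\<close> exactly
  when it negates the square roots of the discriminants of all levels below \<open>n\<close>. A square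
  discriminant at level \<open>n - 1\<close> therefore forbids full cycles on level \<open>n\<close>
  (\<open>no_transitive_orbit_if_disc_square\<close>), while a full cycle on level \<open>n - 1\<close> needs only an
  automorphism that negates the earlier square roots (\<open>transitive_orbit_if_discs_negated\<close>).

  Take \<open>c = g + 4\<close>. The conjugate polynomial \<open>y^2 + 4\<close> has the critical orbit
  \<open>d 0 = 0, d (k + 1) = (d k)^2 + 4\<close>, so the iterate of order \<open>k\<close> sends \<open>g\<close> to \<open>g + d k\<close>, where
  \<open>g\<close> is still free. With \<open>g = 1 - d n\<close> the iterate of order \<open>n\<close> sends \<open>g\<close> to \<open>1\<close>, a square.
  For \<open>1 \<le> k < n\<close> the value \<open>g + d k\<close> is minus a positive integer congruent to \<open>3\<close> modulo \<open>4\<close>.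
  Up to sign and rational squares, the integers \<open>1\<close> and \<open>3\<close> modulo \<open>4\<close> form disjoint classes
  (\<open>odd_class_disjoint\<close>), and these multiply like the signs \<open>1\<close> and \<open>- 1\<close>. As \<open>level_disc k\<close> for
  \<open>k < n - 1\<close> lies in the second class, Kummer theory provides an automorphism that negates all
  their square roots at once (\<open>sign_field_graph\<close>).

  Transitivity cannot be read off from the discriminants, since one of them is a square. Instead
  \<open>f\<close> is congruent to \<open>x^2\<close> modulo \<open>2\<close> with constant coefficient \<open>2\<close> modulo \<open>4\<close>, so all iterates are
  Eisenstein polynomials at \<open>2\<close> and any two roots of the same iterate are conjugate
  (\<open>level_transitive\<close>).

  Both kinds of automorphism first arise as isomorphisms between small subfields of the complex
  numbers. As every vertex is a rational number plus a square root of a linear expression in its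
  parent, it is enough to extend an isomorphism along square roots, by Zorn's lemma, until its domain
  contains the whole tree (\<open>galois_extension\<close>).
\<close>

section \<open>Isomorphisms between subfields of the complex numbers\<close>

text \<open>
  The graph of an isomorphism between two subfields of the complex numbers, presented as a subset of
  the ring \<open>complex \<times> complex\<close>. With this encoding extension is inclusion, and the union of a chain
  of isomorphisms is literally the union of the graphs. The last clause makes the relation
  single-valued; injectivity follows because inverses are taken in both coordinates.
\<close>

definition field_graph :: "(complex \<times> complex) set \<Rightarrow> bool" where
  "field_graph G \<longleftrightarrow> (1, 1) \<in> G \<and>
     (\<forall>a b c d. (a, b) \<in> G \<longrightarrow> (c, d) \<in> G \<longrightarrow> (a - c, b - d) \<in> G \<and> (a * c, b * d) \<in> G) \<and>
     (\<forall>a b. (a, b) \<in> G \<longrightarrow> (inverse a, inverse b) \<in> G) \<and>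
     (\<forall>b. (0, b) \<in> G \<longrightarrow> b = 0)"

context
  fixes G assumes G: "field_graph G"
begin

lemma fg_one: "(1, 1) \<in> G"
  and fg_diff: "(a, b) \<in> G \<Longrightarrow> (c, d) \<in> G \<Longrightarrow> (a - c, b - d) \<in> G"
  and fg_mult: "(a, b) \<in> G \<Longrightarrow> (c, d) \<in> G \<Longrightarrow> (a * c, b * d) \<in> G"
  and fg_inverse: "(a, b) \<in> G \<Longrightarrow> (inverse a, inverse b) \<in> G"
  and fg_zeroD: "(0, b) \<in> G \<Longrightarrow> b = 0"
  using G unfolding field_graph_def by blast+

lemma fg_zero: "(0, 0) \<in> G"
  using fg_diff[OF fg_one fg_one] by simp

lemma fg_uminus: "(a, b) \<in> G \<Longrightarrow> (- a, - b) \<in> G"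
  using fg_diff[OF fg_zero] by fastforce

lemma fg_add: "(a, b) \<in> G \<Longrightarrow> (c, d) \<in> G \<Longrightarrow> (a + c, b + d) \<in> G"
  using fg_diff[OF _ fg_uminus] by fastforce

lemma fg_divide: "(a, b) \<in> G \<Longrightarrow> (c, d) \<in> G \<Longrightarrow> (a / c, b / d) \<in> G"
  using fg_mult[OF _ fg_inverse] by (simp add: divide_inverse)

lemma fg_square: "(a, b) \<in> G \<Longrightarrow> (a\<^sup>2, b\<^sup>2) \<in> G"
  by (simp add: power2_eq_square fg_mult)

lemma fg_of_nat: "(of_nat k, of_nat k) \<in> G"
  by (induction k) (auto intro: fg_zero fg_one fg_add)

lemma fg_of_int: "(of_int k, of_int k) \<in> G"
  by (cases k) (auto intro!: fg_of_nat fg_uminus fg_diff fg_one simp del: of_nat_Suc)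

lemma fg_Rats: "q \<in> \<rat> \<Longrightarrow> (q, q) \<in> G"
  by (metis Rats_cases' fg_divide fg_of_int)

lemma fg_fun: "(a, b) \<in> G \<Longrightarrow> (a, b') \<in> G \<Longrightarrow> b = b'"
  using fg_diff fg_zeroD by fastforce

text \<open>
  If \<open>a \<noteq> 0\<close> were related to \<open>0\<close>, then multiplying by the inverse pair would relate \<open>1\<close> to \<open>0\<close>.
\<close>

lemma fg_zero_iff: assumes "(a, b) \<in> G" shows "a = 0 \<longleftrightarrow> b = 0"
proof
  assume "b = 0"
  show "a = 0"
  proof (rule ccontr)
    assume "a \<noteq> 0"
    then have "(1, 0) \<in> G" using fg_mult[OF assms fg_inverse[OF assms]] \<open>b = 0\<close> by simp
    then show False using fg_fun[OF fg_one, of 0] by simp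
  qed
qed (use assms fg_zeroD in simp)

lemma fg_poly: "(z, w) \<in> G \<Longrightarrow> (poly (cpoly g) z, poly (cpoly g) w) \<in> G"
proof (induction g)
  case (pCons a p)
  then show ?case by (auto simp: map_poly_pCons intro!: fg_add fg_mult fg_of_int)
qed (simp add: fg_zero)

end

definition adjoin :: "(complex \<times> complex) set \<Rightarrow> complex \<Rightarrow> complex \<Rightarrow> (complex \<times> complex) set" where
  "adjoin G w v = {(a + c * w, b + d * v) | a b c d. (a, b) \<in> G \<and> (c, d) \<in> G}"

lemma adjoin_subset:
  assumes "field_graph G" shows "G \<subseteq> adjoin G w v"
proof
  fix p assume "p \<in> G"
  then show "p \<in> adjoin G w v"
    using fg_zero[OF assms] unfolding adjoin_def
    by (cases p) (force intro: exI[of _ 0])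
qed

lemma adjoin_generator:
  assumes "field_graph G" shows "(w, v) \<in> adjoin G w v"
  using fg_zero[OF assms] fg_one[OF assms] unfolding adjoin_def
  by (force intro: exI[of _ 0] exI[of _ 1])

text \<open>
  Since \<open>w\<close> lies outside the domain, \<open>1\<close> and \<open>w\<close> are linearly independent over it, so an element
  \<open>a + c w\<close> determines its image. Inverses are obtained by multiplying with the conjugate
  \<open>a - c w\<close>.
\<close>

lemma field_graph_adjoin:
  assumes G: "field_graph G" and w: "w \<notin> Domain G" and sq: "(w\<^sup>2, v\<^sup>2) \<in> G"
  shows "field_graph (adjoin G w v)"
proof -
  let ?H = "adjoin G w v"
  have H: "(a + c * w, b + d * v) \<in> ?H" if "(a, b) \<in> G" "(c, d) \<in> G" for a b c d
    using that unfolding adjoin_def by blast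
  have indep: "c = 0 \<and> a = 0" if "(a, b) \<in> G" "(c, d) \<in> G" "a + c * w = 0" for a b c d
  proof (rule ccontr)
    assume "\<not> (c = 0 \<and> a = 0)"
    then have "c \<noteq> 0" using that by auto
    then have "w = - a / c" using that(3) by (simp add: field_simps eq_neg_iff_add_eq_0)
    then have "(w, - b / d) \<in> G" using that fg_uminus[OF G] fg_divide[OF G] by metis
    then show False using w by blast
  qed
  have mul: "((a + c * w) * (a' + c' * w), (b + d * v) * (b' + d' * v)) \<in> ?H"
    if "(a, b) \<in> G" "(c, d) \<in> G" "(a', b') \<in> G" "(c', d') \<in> G" for a b c d a' b' c' d'
  proof -
    have "(a * a' + c * c' * w\<^sup>2 + (a * c' + c * a') * w, b * b' + d * d' * v\<^sup>2 + (b * d' + d * b') * v) \<in> ?H"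
      by (intro H fg_add[OF G] fg_mult[OF G] that sq)
    then show ?thesis by (simp add: algebra_simps power2_eq_square)
  qed
  have inv: "(inverse (a + c * w), inverse (b + d * v)) \<in> ?H" if ab: "(a, b) \<in> G" and cd: "(c, d) \<in> G" for a b c d
  proof (cases "a + c * w = 0")
    case True
    then have "a = 0" "c = 0" using indep[OF ab cd] by auto
    then have "b = 0" "d = 0" using ab cd fg_zeroD[OF G] by auto
    then show ?thesis using True fg_zero[OF G] adjoin_subset[OF G] by auto
  next
    case False
    let ?n = "a\<^sup>2 - c\<^sup>2 * w\<^sup>2" and ?m = "b\<^sup>2 - d\<^sup>2 * v\<^sup>2"
    have nm: "(?n, ?m) \<in> G" by (intro fg_diff[OF G] fg_mult[OF G] fg_square[OF G] ab cd sq)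
    have "a - c * w \<noteq> 0"
      using indep[OF ab fg_uminus[OF G cd]] False by auto
    moreover have n: "?n = (a + c * w) * (a - c * w)" and m: "?m = (b + d * v) * (b - d * v)"
      by (simp_all add: algebra_simps power2_eq_square)
    ultimately have "?n \<noteq> 0" using False by simp
    then have "?m \<noteq> 0" using fg_zero_iff[OF G nm] by simp
    have "inverse (a + c * w) = a / ?n + (- c / ?n) * w" "inverse (b + d * v) = b / ?m + (- d / ?m) * v"
      using \<open>?n \<noteq> 0\<close> \<open>?m \<noteq> 0\<close> unfolding n m by (auto simp: divide_simps)
    then show ?thesis using H fg_divide[OF G _ nm] fg_uminus[OF G] ab cd by metis
  qed
  show ?thesis
    unfolding field_graph_def
  proof (intro conjI allI impI)
    show "(1, 1) \<in> ?H" using adjoin_subset[OF G] fg_one[OF G] by blast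
  next
    fix a b c d assume "(a, b) \<in> ?H" "(c, d) \<in> ?H"
    then obtain a1 a2 b1 b2 c1 c2 d1 d2
      where *: "(a1, b1) \<in> G" "(a2, b2) \<in> G" "(c1, d1) \<in> G" "(c2, d2) \<in> G"
        and eq: "a = a1 + a2 * w" "b = b1 + b2 * v" "c = c1 + c2 * w" "d = d1 + d2 * v"
      unfolding adjoin_def by blast
    have "((a1 - c1) + (a2 - c2) * w, (b1 - d1) + (b2 - d2) * v) \<in> ?H"
      by (intro H fg_diff[OF G] *)
    then show "(a - c, b - d) \<in> ?H" unfolding eq by (simp add: algebra_simps)
    show "(a * c, b * d) \<in> ?H" unfolding eq by (intro mul *)
  next
    fix a b assume "(a, b) \<in> ?H"
    then show "(inverse a, inverse b) \<in> ?H" using inv unfolding adjoin_def by blast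
  next
    fix b assume "(0, b) \<in> ?H"
    then obtain a1 a2 b1 b2 where *: "(a1, b1) \<in> G" "(a2, b2) \<in> G" "0 = a1 + a2 * w" "b = b1 + b2 * v"
      unfolding adjoin_def by blast
    then have "a1 = 0" "a2 = 0" using indep by metis+
    then have "b1 = 0" "b2 = 0" using * fg_zeroD[OF G] by auto
    then show "b = 0" using * by simp
  qed
qed

lemma field_graph_Union:
  assumes ne: "C \<noteq> {}" and chain: "subset.chain {G. field_graph G} C"
  shows "field_graph (\<Union>C)"
proof -
  have fg: "field_graph G" if "G \<in> C" for G using chain that by (auto simp: subset.chain_def)
  have common: "\<exists>G\<in>C. p \<in> G \<and> q \<in> G" if "p \<in> \<Union>C" "q \<in> \<Union>C" for p q
    using that chain unfolding subset.chain_def by blast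
  show ?thesis
    unfolding field_graph_def
  proof (intro conjI allI impI)
    show "(1, 1) \<in> \<Union>C" using ne fg fg_one by blast
  next
    fix a b c d assume "(a, b) \<in> \<Union>C" "(c, d) \<in> \<Union>C"
    then obtain G where "G \<in> C" "(a, b) \<in> G" "(c, d) \<in> G" using common by blast
    then show "(a - c, b - d) \<in> \<Union>C" "(a * c, b * d) \<in> \<Union>C"
      using fg fg_diff fg_mult by blast+
  next
    fix a b assume "(a, b) \<in> \<Union>C"
    then show "(inverse a, inverse b) \<in> \<Union>C" using fg fg_inverse by blast
  next
    fix b assume "(0, b) \<in> \<Union>C"
    then show "b = 0" using fg fg_zeroD by blast
  qed
qed

text \<open>
  A maximal extension, given by Zorn's lemma, is closed under square roots: a missing root of an
  element of the domain could be adjoined and sent to a complex square root of the image.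
\<close>

lemma field_graph_sqrt_closure:
  assumes G: "field_graph G"
  obtains M where "field_graph M" "G \<subseteq> M" "\<And>w. w\<^sup>2 \<in> Domain M \<Longrightarrow> w \<in> Domain M"
proof -
  define S where "S = {H. field_graph H \<and> G \<subseteq> H}"
  have "\<exists>M\<in>S. \<forall>H\<in>S. M \<subseteq> H \<longrightarrow> H = M"
  proof (rule subset_Zorn_nonempty)
    fix C assume C: "C \<noteq> {}" "subset.chain S C"
    then have "C \<subseteq> S" by (simp add: subset.chain_def)
    have "subset.chain {G. field_graph G} C" using C(2) unfolding subset.chain_def S_def by fast
    then have "field_graph (\<Union>C)" by (rule field_graph_Union[OF C(1)])
    moreover obtain H where "H \<in> C" "G \<subseteq> H" using C(1) \<open>C \<subseteq> S\<close> unfolding S_def by blast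
    then have "G \<subseteq> \<Union>C" by blast
    ultimately show "\<Union>C \<in> S" by (simp add: S_def)
  qed (use G in \<open>auto simp: S_def\<close>)
  then obtain M where MS: "M \<in> S" and max: "\<And>H. H \<in> S \<Longrightarrow> M \<subseteq> H \<Longrightarrow> H = M"
    by meson
  then have M: "field_graph M" "G \<subseteq> M" by (simp_all add: S_def)
  have "w \<in> Domain M" if "w\<^sup>2 \<in> Domain M" for w
  proof (rule ccontr)
    assume w: "w \<notin> Domain M"
    from that obtain u where "(w\<^sup>2, u) \<in> M" by blast
    then have "(w\<^sup>2, (csqrt u)\<^sup>2) \<in> M" by simp
    from field_graph_adjoin[OF M(1) w this] have "adjoin M w (csqrt u) \<in> S"
      using adjoin_subset[OF M(1)] M(2) unfolding S_def by fast
    then have "adjoin M w (csqrt u) = M" by (rule max[OF _ adjoin_subset[OF M(1)]])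
    then show False using adjoin_generator[OF M(1), of w "csqrt u"] w by blast
  qed
  with that M show ?thesis by blast
qed


section \<open>Levels of the tree and extension of isomorphisms\<close>

lemma arboreal_field_induct [consumes 1, case_names rat tree minus inverse add mult]:
  assumes "x \<in> carrier (arboreal_field f)"
    and "\<And>q. q \<in> \<rat> \<Longrightarrow> P q" "\<And>z. z \<in> preimage_tree f \<Longrightarrow> P z"
    and "\<And>a. P a \<Longrightarrow> P (- a)" "\<And>a. P a \<Longrightarrow> P (inverse a)"
    and "\<And>a b. P a \<Longrightarrow> P b \<Longrightarrow> P (a + b)" "\<And>a b. P a \<Longrightarrow> P b \<Longrightarrow> P (a * b)"
  shows "P x"
proof -
  let ?R = "ring_of_type_algebra :: complex ring"
  interpret R: field ?R by (rule field_from_type_algebra)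
  have neg: "\<ominus>\<^bsub>?R\<^esub> a = - a" for a
    by (rule R.minus_equality) (auto simp: ring_of_type_algebra_def)
  have inv: "inv\<^bsub>?R\<^esub> a = inverse a" if "a \<noteq> 0" for a
    by (rule R.comm_inv_char) (use that in \<open>auto simp: ring_of_type_algebra_def\<close>)
  have "x \<in> generate_field ?R (\<rat> \<union> preimage_tree f)"
    using assms(1) by (simp add: arboreal_field_def)
  then show ?thesis
  proof induction
    case one
    show ?case using assms(2)[of 1] by (simp add: ring_of_type_algebra_def)
  next
    case (m_inv h)
    then have "h \<noteq> 0" by (simp add: ring_of_type_algebra_def)
    then show ?case using assms(5) m_inv inv by simp
  qed (use assms neg in \<open>auto simp: ring_of_type_algebra_def\<close>)
qed

lemma arboreal_field_uminus:
  "a \<in> carrier (arboreal_field f) \<Longrightarrow> - a \<in> carrier (arboreal_field f)"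
  using arboreal_field_closed(2)[OF arboreal_field_incl(1)[of "-1"]] by fastforce

lemma arboreal_field_inverse:
  assumes "a \<in> carrier (arboreal_field f)" shows "inverse a \<in> carrier (arboreal_field f)"
proof (cases "a = 0")
  case False
  let ?R = "ring_of_type_algebra :: complex ring"
  interpret R: field ?R by (rule field_from_type_algebra)
  have "inv\<^bsub>?R\<^esub> a = inverse a"
    by (rule R.comm_inv_char) (use False in \<open>auto simp: ring_of_type_algebra_def\<close>)
  then show ?thesis
    using generate_field.m_inv[of a ?R "\<rat> \<union> preimage_tree f"] False assms
    by (simp add: arboreal_field_def ring_of_type_algebra_def)
qed (use assms in simp)

definition shifted_square :: "int \<Rightarrow> int \<Rightarrow> int poly" where
  "shifted_square g c = [:g\<^sup>2 + c, - 2 * g, 1:]"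

lemma poly_shifted_square:
  "poly (cpoly (shifted_square g c)) z = (z - of_int g)\<^sup>2 + of_int c"
  by (simp add: shifted_square_def map_poly_pCons algebra_simps power2_eq_square)

lemma level_0: "preimage_level f 0 = {0}"
  by (auto simp: preimage_level_def)

lemma level_Suc_iff: "z \<in> preimage_level f (Suc k) \<longleftrightarrow> poly (cpoly f) z \<in> preimage_level f k"
  by (simp add: preimage_level_def funpow_swap1)

lemma level_in_tree: "z \<in> preimage_level f k \<Longrightarrow> z \<in> preimage_tree f"
  by (auto simp: preimage_tree_def)

lemma tree_in_level: "z \<in> preimage_tree f \<Longrightarrow> \<exists>k. z \<in> preimage_level f k"
  by (auto simp: preimage_tree_def)

lemma shifted_square_fibre:
  "poly (cpoly (shifted_square g c)) z = y \<longleftrightarrow>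
     z = of_int g + csqrt (y - of_int c) \<or> z = of_int g - csqrt (y - of_int c)"
proof -
  have "poly (cpoly (shifted_square g c)) z = y \<longleftrightarrow> (z - of_int g)\<^sup>2 = (csqrt (y - of_int c))\<^sup>2"
    by (auto simp: poly_shifted_square algebra_simps)
  then show ?thesis unfolding power2_eq_iff by (auto simp: algebra_simps)
qed

text \<open>
  The complex square root picks one of the two preimages of a vertex \<open>y\<close>, namely \<open>g + csqrt (y - c)\<close>.
\<close>

lemma level_Suc_Union:
  "preimage_level (shifted_square g c) (Suc k) = (\<Union>y\<in>preimage_level (shifted_square g c) k.
     {of_int g + csqrt (y - of_int c), of_int g - csqrt (y - of_int c)})"
  by (rule Set.set_eqI)
    (simp only: level_Suc_iff UN_iff insert_iff empty_iff simp_thms shifted_square_fibre[symmetric], simp)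

lemma finite_level: "finite (preimage_level (shifted_square g c) k)"
  by (induction k) (simp_all add: level_0 level_Suc_Union)

text \<open>
  An extension of the isomorphism whose domain is closed under square roots is defined on the tree,
  level by level, hence on the field generated by the tree. It permutes each level because it
  commutes with \<open>f\<close> and the levels are finite, so it maps the generated field onto itself.
\<close>

lemma galois_extension:
  fixes g c :: int
  assumes G: "field_graph G"
  defines "f \<equiv> shifted_square g c"
  obtains \<sigma> where "\<sigma> \<in> rat_galois_group (arboreal_field f)"
    and "\<And>x y. (x, y) \<in> G \<Longrightarrow> x \<in> carrier (arboreal_field f) \<Longrightarrow> \<sigma> x = y"
proof -
  let ?K = "carrier (arboreal_field f)" and ?T = "preimage_tree f"
  obtain M where M: "field_graph M" "G \<subseteq> M"
    and sq: "\<And>w. w\<^sup>2 \<in> Domain M \<Longrightarrow> w \<in> Domain M"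
    using field_graph_sqrt_closure[OF G] by blast
  have "z \<in> Domain M" if "z \<in> preimage_level f k" for z k
    using that
  proof (induction k arbitrary: z)
    case 0
    then show ?case using fg_zero[OF M(1)] by (auto simp: level_0)
  next
    case (Suc k)
    then obtain u where u: "((z - of_int g)\<^sup>2 + of_int c, u) \<in> M"
      by (auto simp: level_Suc_iff f_def poly_shifted_square)
    from fg_diff[OF M(1) this fg_of_int[OF M(1), of c]]
    have "(z - of_int g)\<^sup>2 \<in> Domain M" by auto
    then obtain v where "(z - of_int g, v) \<in> M" using sq by blast
    from fg_add[OF M(1) this fg_of_int[OF M(1), of g]] show ?case by auto
  qed
  then have dom_tree: "z \<in> Domain M" if "z \<in> ?T" for z
    using that tree_in_level by blast
  define h where "h x = (THE y. (x, y) \<in> M)" for x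
  have hI: "h x = y" if "(x, y) \<in> M" for x y
    unfolding h_def using that fg_fun[OF M(1)] by blast
  have dom: "(x, h x) \<in> M" if "x \<in> ?K" for x
  proof -
    from that have "x \<in> Domain M"
    proof (induction rule: arboreal_field_induct)
      case (rat q) then show ?case using fg_Rats[OF M(1)] by blast
    next
      case (tree z) then show ?case by (rule dom_tree)
    next
      case (minus a) then show ?case using fg_uminus[OF M(1)] by blast
    next
      case (inverse a) then show ?case using fg_inverse[OF M(1)] by blast
    next
      case (add a b) then show ?case using fg_add[OF M(1)] by blast
    next
      case (mult a b) then show ?case using fg_mult[OF M(1)] by blast
    qed
    then show ?thesis using hI by blast
  qed
  have h_rat: "h q = q" if "q \<in> \<rat>" for q using that by (rule hI[OF fg_Rats[OF M(1)]])
  have h_minus: "h (- a) = - h a" and h_inverse: "h (inverse a) = inverse (h a)" if "a \<in> ?K" for a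
    by (rule hI[OF fg_uminus[OF M(1) dom[OF that]]], rule hI[OF fg_inverse[OF M(1) dom[OF that]]])
  have h_add: "h (a + b) = h a + h b" and h_mult: "h (a * b) = h a * h b" if "a \<in> ?K" "b \<in> ?K" for a b
    by (rule hI[OF fg_add[OF M(1) dom[OF that(1)] dom[OF that(2)]]],
      rule hI[OF fg_mult[OF M(1) dom[OF that(1)] dom[OF that(2)]]])
  have inj: "inj_on h ?K"
  proof (rule inj_onI)
    fix a b assume ab: "a \<in> ?K" "b \<in> ?K" "h a = h b"
    then have "(a - b, 0) \<in> M" using fg_diff[OF M(1) dom[OF ab(1)] dom[OF ab(2)]] by simp
    then show "a = b" using fg_zero_iff[OF M(1)] by fastforce
  qed
  have h_level: "h z \<in> preimage_level f k" if "z \<in> preimage_level f k" for z k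
  proof -
    have "((poly (cpoly f) ^^ j) z, (poly (cpoly f) ^^ j) (h z)) \<in> M" for j
      using dom[OF arboreal_field_incl(2)[OF level_in_tree[OF that]]]
      by (induction j) (auto intro: fg_poly[OF M(1)])
    from this[of k] show ?thesis using that fg_zeroD[OF M(1)] by (simp add: preimage_level_def)
  qed
  have h_level_onto: "preimage_level f k \<subseteq> h ` preimage_level f k" for k
  proof -
    have "inj_on h (preimage_level f k)"
      using inj by (rule inj_on_subset) (auto intro: arboreal_field_incl level_in_tree)
    moreover have "h ` preimage_level f k \<subseteq> preimage_level f k" using h_level by blast
    ultimately show ?thesis
      using endo_inj_surj[OF finite_level[of g c k, folded f_def]] by blast
  qed
  have into: "h x \<in> ?K" if "x \<in> ?K" for x
  proof -
    from that have "x \<in> ?K \<and> h x \<in> ?K"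
    proof (induction rule: arboreal_field_induct)
      case (tree z)
      then show ?case using h_level tree_in_level level_in_tree arboreal_field_incl(2) by metis
    qed (auto simp: h_rat h_minus h_inverse h_add h_mult
        intro: arboreal_field_incl arboreal_field_uminus arboreal_field_inverse arboreal_field_closed)
    then show ?thesis ..
  qed
  have onto: "x \<in> h ` ?K" if "x \<in> ?K" for x
    using that
  proof (induction rule: arboreal_field_induct)
    case (rat q)
    then show ?case using h_rat arboreal_field_incl(1) by (metis imageI)
  next
    case (tree z)
    then show ?case using tree_in_level h_level_onto level_in_tree arboreal_field_incl(2) by blast
  next
    case (minus a)
    then obtain b where "b \<in> ?K" "a = h b" by blast
    then show ?case using h_minus arboreal_field_uminus by (intro image_eqI[of _ _ "- b"]) auto
  next
    case (inverse a)
    then obtain b where "b \<in> ?K" "a = h b" by blast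
    then show ?case using h_inverse arboreal_field_inverse by (intro image_eqI[of _ _ "inverse b"]) auto
  next
    case (add a a')
    then obtain b b' where "b \<in> ?K" "a = h b" "b' \<in> ?K" "a' = h b'" by blast
    then show ?case using h_add arboreal_field_closed(1) by (intro image_eqI[of _ _ "b + b'"]) auto
  next
    case (mult a a')
    then obtain b b' where "b \<in> ?K" "a = h b" "b' \<in> ?K" "a' = h b'" by blast
    then show ?case using h_mult arboreal_field_closed(2) by (intro image_eqI[of _ _ "b * b'"]) auto
  qed
  define \<sigma> where "\<sigma> = restrict h ?K"
  have "bij_betw \<sigma> ?K ?K"
    unfolding \<sigma>_def bij_betw_def using inj into onto by auto
  then have "\<sigma> \<in> rat_galois_group (arboreal_field f)"
    unfolding rat_galois_group_def ring_iso_def ring_hom_def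
    using into h_rat h_add h_mult arboreal_field_closed[of _ f] arboreal_field_incl(1)[of _ f]
    by (auto simp: \<sigma>_def)
  moreover have "\<sigma> x = y" if "(x, y) \<in> G" "x \<in> ?K" for x y
    using hI that M(2) unfolding \<sigma>_def by auto
  ultimately show ?thesis using that by blast
qed


section \<open>Eisenstein polynomials and transitivity\<close>

lemma poly_cpoly_add: "poly (cpoly (p + q)) z = poly (cpoly p) z + poly (cpoly q) z"
proof -
  have "cpoly (p + q) = cpoly p + cpoly q" by (rule Polynomial.poly_eqI) (simp add: coeff_map_poly)
  then show ?thesis by simp
qed

lemma poly_cpoly_smult: "poly (cpoly (Polynomial.smult a p)) z = of_int a * poly (cpoly p) z"
proof -
  have "cpoly (Polynomial.smult a p) = Polynomial.smult (of_int a) (cpoly p)"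
    by (rule Polynomial.poly_eqI) (simp add: coeff_map_poly)
  then show ?thesis by simp
qed

lemma poly_cpoly_diff: "poly (cpoly (p - q)) z = poly (cpoly p) z - poly (cpoly q) z"
  using poly_cpoly_add[of p "Polynomial.smult (- 1) q" z] poly_cpoly_smult[of "- 1" q z] by simp

lemma poly_cpoly_mult: "poly (cpoly (p * q)) z = poly (cpoly p) z * poly (cpoly q) z"
proof (induction p)
  case (pCons a p)
  then show ?case
    by (simp add: poly_cpoly_add poly_cpoly_smult map_poly_pCons algebra_simps)
qed simp

definition eisenstein :: "int \<Rightarrow> int poly \<Rightarrow> bool" where
  "eisenstein p h \<longleftrightarrow> prime p \<and> (\<forall>i < Polynomial.degree h. p dvd poly.coeff h i) \<and>
     \<not> p dvd Polynomial.lead_coeff h \<and> \<not> p\<^sup>2 dvd poly.coeff h 0"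

text \<open>
  Modulo \<open>p\<close> the product \<open>q r\<close> is a multiple of the leading monomial of \<open>h\<close>. If \<open>r\<close> has a nonzero
  constant coefficient modulo \<open>p\<close>, then the lowest monomial of \<open>q\<close> modulo \<open>p\<close> survives in the
  product in a degree below that of \<open>h\<close>.
\<close>

lemma eisenstein_factor_aux:
  assumes h: "eisenstein p h" and fac: "Polynomial.smult a h = q * r" and "\<not> p dvd a"
    and r: "Polynomial.degree r > 0" "\<not> p dvd poly.coeff r 0"
  shows False
proof -
  have p: "prime p" and low: "\<And>i. i < Polynomial.degree h \<Longrightarrow> p dvd poly.coeff h i"
    and lead: "\<not> p dvd Polynomial.lead_coeff h"
    using h unfolding eisenstein_def by auto
  have "a \<noteq> 0" "h \<noteq> 0" using \<open>\<not> p dvd a\<close> lead by auto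
  then have "q \<noteq> 0" "r \<noteq> 0" using fac by auto
  then have deg: "Polynomial.degree q + Polynomial.degree r = Polynomial.degree h"
    using \<open>a \<noteq> 0\<close> fac by (metis Polynomial.degree_mult_eq Polynomial.degree_smult_eq)
  have "Polynomial.lead_coeff q * Polynomial.lead_coeff r = a * Polynomial.lead_coeff h"
    by (metis fac Polynomial.lead_coeff_mult Polynomial.lead_coeff_smult)
  then have "\<not> p dvd Polynomial.lead_coeff q"
    using lead \<open>\<not> p dvd a\<close> p by (metis dvd_mult2 prime_dvd_mult_iff)
  define i where "i = (LEAST i. \<not> p dvd poly.coeff q i)"
  have i: "\<not> p dvd poly.coeff q i" and "i \<le> Polynomial.degree q"
    unfolding i_def using \<open>\<not> p dvd Polynomial.lead_coeff q\<close> by (rule LeastI, rule Least_le)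
  have less: "p dvd poly.coeff q j" if "j < i" for j
    using not_less_Least[of j "\<lambda>i. \<not> p dvd poly.coeff q i"] that unfolding i_def by blast
  have "i < Polynomial.degree h" using \<open>i \<le> Polynomial.degree q\<close> deg r(1) by linarith
  then have "p dvd poly.coeff (q * r) i" unfolding fac[symmetric] using low by simp
  also have "poly.coeff (q * r) i = (\<Sum>j<i. poly.coeff q j * poly.coeff r (i - j)) + poly.coeff q i * poly.coeff r 0"
    by (simp add: Polynomial.coeff_mult lessThan_Suc_atMost[symmetric])
  finally have "p dvd poly.coeff q i * poly.coeff r 0"
    using less by (metis (no_types, lifting) dvd_add_right_iff dvd_mult2 dvd_sum lessThan_iff)
  then show False using i r(2) p prime_dvd_mult_iff by blast
qed

text \<open>
  At most one of the two constant coefficients is divisible by \<open>p\<close>, because \<open>p^2\<close> does not divide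
  their product. Multiples of \<open>h\<close> are allowed because they are what pseudo-division produces.
\<close>

lemma eisenstein_no_factor:
  assumes h: "eisenstein p h" and fac: "Polynomial.smult a h = q * r" and a: "\<not> p dvd a"
  shows "Polynomial.degree q = 0 \<or> Polynomial.degree r = 0"
proof (rule ccontr)
  assume "\<not> ?thesis"
  then have q: "Polynomial.degree q > 0" and r: "Polynomial.degree r > 0" by auto
  have p: "prime p" and "\<not> p\<^sup>2 dvd poly.coeff h 0" using h unfolding eisenstein_def by auto
  moreover have "coprime (p\<^sup>2) a" using p a by (simp add: prime_imp_coprime)
  ultimately have "\<not> p\<^sup>2 dvd a * poly.coeff h 0" by (simp add: coprime_dvd_mult_right_iff)
  moreover have "a * poly.coeff h 0 = poly.coeff q 0 * poly.coeff r 0"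
    using arg_cong[OF fac, of "\<lambda>u. poly.coeff u 0"] by (simp add: Polynomial.coeff_mult_0)
  ultimately have "\<not> (p dvd poly.coeff q 0 \<and> p dvd poly.coeff r 0)"
    by (metis mult_dvd_mono power2_eq_square)
  moreover have "Polynomial.smult a h = r * q" using fac by (simp add: mult.commute)
  ultimately show False
    using eisenstein_factor_aux[OF h fac a r] eisenstein_factor_aux[OF h _ a q] by blast
qed

text \<open>
  Pseudo-division of \<open>h\<close> by an integer polynomial \<open>v\<close> of least degree vanishing at \<open>x\<close> leaves no
  remainder, so \<open>v\<close> divides a multiple \<open>a h\<close>. This is a version of the Gauss lemma: a factor \<open>p\<close> of
  \<open>a\<close> can be moved out of \<open>v\<close> or its cofactor, so \<open>a\<close> may be taken prime to \<open>p\<close>, and then the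
  Eisenstein criterion applies.
\<close>

lemma eisenstein_minimal:
  fixes x :: complex
  assumes h: "eisenstein p h" and hx: "poly (cpoly h) x = 0"
    and u: "poly (cpoly u) x = 0" "u \<noteq> 0"
  shows "Polynomial.degree h \<le> Polynomial.degree u"
proof (rule ccontr)
  assume less: "\<not> ?thesis"
  have p: "prime p" and "h \<noteq> 0" using h unfolding eisenstein_def by auto
  define root where "root v \<longleftrightarrow> v \<noteq> 0 \<and> poly (cpoly v) x = 0" for v
  define d where "d = (LEAST d. \<exists>v. root v \<and> Polynomial.degree v = d)"
  have ex: "\<exists>v. root v \<and> Polynomial.degree v = Polynomial.degree u" using u by (auto simp: root_def)
  have "\<exists>v. root v \<and> Polynomial.degree v = d"
    unfolding d_def by (rule LeastI[where P = "\<lambda>d. \<exists>v. root v \<and> Polynomial.degree v = d", OF ex])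
  then obtain v where v: "root v" "Polynomial.degree v = d" by blast
  have min: "d \<le> Polynomial.degree w" if "root w" for w
    unfolding d_def using that by (intro Least_le) blast
  have "d < Polynomial.degree h" using min[of u] u less by (simp add: root_def)
  have "d \<noteq> 0"
  proof
    assume "d = 0"
    then obtain e where "v = [:e:]" using v(2) by (auto elim: Polynomial.degree_eq_zeroE)
    then show False using v(1) by (auto simp: root_def map_poly_pCons)
  qed
  obtain a q where aq: "a \<noteq> 0" "Polynomial.smult a h = v * q"
  proof -
    obtain a q where a: "a \<noteq> 0" "Polynomial.smult a h = v * q + pseudo_mod h v"
      and deg: "pseudo_mod h v = 0 \<or> Polynomial.degree (pseudo_mod h v) < Polynomial.degree v"
      using pseudo_mod[of v h] v(1) by (auto simp: root_def)
    have "poly (cpoly (Polynomial.smult a h)) x = poly (cpoly (v * q + pseudo_mod h v)) x"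
      by (simp only: a(2))
    then have "poly (cpoly (pseudo_mod h v)) x = 0"
      using hx v(1) by (simp add: root_def poly_cpoly_add poly_cpoly_mult poly_cpoly_smult)
    then have "pseudo_mod h v = 0" 
      using deg min[of "pseudo_mod h v"] v(2) by (cases "pseudo_mod h v = 0") (auto simp: root_def)
    then show ?thesis using a that by simp
  qed
  \<comment> \<open>Among all factorizations of multiples of \<open>h\<close> with a factor of degree \<open>d\<close>, one with the least multiplier has its multiplier prime to \<open>p\<close>.\<close>
  define fac where "fac m \<longleftrightarrow> (\<exists>a v q. m = nat \<bar>a\<bar> \<and> a \<noteq> 0 \<and> Polynomial.degree v = d \<and> Polynomial.smult a h = v * q)" for m
  have "fac (nat \<bar>a\<bar>)" unfolding fac_def using aq v(2) by blast
  then have "fac (LEAST m. fac m)" by (rule LeastI)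
  then obtain a v q where a: "(LEAST m. fac m) = nat \<bar>a\<bar>" "a \<noteq> 0" "Polynomial.degree v = d" "Polynomial.smult a h = v * q"
    unfolding fac_def[of "LEAST m. fac m"] by blast
  have "\<not> p dvd a"
  proof
    assume "p dvd a"
    then obtain b where b: "a = p * b" by blast
    have "p \<noteq> 0" "b \<noteq> 0" using a(2) b by auto
    have "[:p:] dvd v * q" 
    proof
      show "v * q = [:p:] * Polynomial.smult b h" unfolding a(4)[symmetric] b by (simp add: mult.commute)
    qed
    moreover have "prime_elem [:p:]" using prime_imp_prime_elem[OF p] by (simp add: prime_elem_const_poly_iff)
    ultimately have "[:p:] dvd v \<or> [:p:] dvd q" by (simp add: prime_elem_dvd_mult_iff)
    then have "fac (nat \<bar>b\<bar>)"
    proof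
      assume "[:p:] dvd v"
      then obtain v' where v': "v = Polynomial.smult p v'" by (auto elim!: dvdE)
      then have "Polynomial.smult p (Polynomial.smult b h) = Polynomial.smult p (v' * q)"
        using a(4) b by simp
      then have "Polynomial.smult b h = v' * q" using \<open>p \<noteq> 0\<close> Polynomial.smult_cancel by blast
      moreover have "Polynomial.degree v' = d" using a(3) v' \<open>p \<noteq> 0\<close> by simp
      ultimately show ?thesis unfolding fac_def using \<open>b \<noteq> 0\<close> by blast
    next
      assume "[:p:] dvd q"
      then obtain q' where q': "q = Polynomial.smult p q'" by (auto elim!: dvdE)
      then have "Polynomial.smult p (Polynomial.smult b h) = Polynomial.smult p (v * q')"
        using a(4) b by simp
      then have "Polynomial.smult b h = v * q'" using \<open>p \<noteq> 0\<close> Polynomial.smult_cancel by blast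
      then show ?thesis unfolding fac_def using \<open>b \<noteq> 0\<close> a(3) by blast
    qed
    then have "nat \<bar>a\<bar> \<le> nat \<bar>b\<bar>" unfolding a(1)[symmetric] by (rule Least_le)
    moreover have "\<bar>b\<bar> < \<bar>a\<bar>" using b \<open>b \<noteq> 0\<close> prime_gt_1_int[OF p] by (simp add: abs_mult)
    ultimately show False by linarith
  qed
  then have "Polynomial.degree v = 0 \<or> Polynomial.degree q = 0" by (rule eisenstein_no_factor[OF h a(4)])
  moreover have "Polynomial.degree h = Polynomial.degree v + Polynomial.degree q"
    using a(2,4) \<open>h \<noteq> 0\<close> by (metis Polynomial.degree_mult_eq Polynomial.degree_smult_eq Polynomial.smult_eq_0_iff mult_eq_0_iff)
  ultimately show False using a(3) \<open>d \<noteq> 0\<close> \<open>d < Polynomial.degree h\<close> by simp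
qed

lemma eisenstein_conjugate:
  fixes x y :: complex
  assumes h: "eisenstein p h" and x: "poly (cpoly h) x = 0" and y: "poly (cpoly h) y = 0"
    and u: "poly (cpoly u) x = 0"
  shows "poly (cpoly u) y = 0"
proof -
  have "h \<noteq> 0" using h unfolding eisenstein_def by auto
  then obtain a q where a: "a \<noteq> 0" "Polynomial.smult a u = h * q + pseudo_mod u h"
    and deg: "pseudo_mod u h = 0 \<or> Polynomial.degree (pseudo_mod u h) < Polynomial.degree h"
    using pseudo_mod[of h u] by auto
  have "poly (cpoly (Polynomial.smult a u)) z = poly (cpoly (h * q + pseudo_mod u h)) z" for z
    by (simp only: a(2))
  then have eq: "of_int a * poly (cpoly u) z = poly (cpoly h) z * poly (cpoly q) z + poly (cpoly (pseudo_mod u h)) z" for z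
    by (simp add: poly_cpoly_add poly_cpoly_mult poly_cpoly_smult)
  have "pseudo_mod u h = 0"
    using eisenstein_minimal[OF h x, of "pseudo_mod u h"] eq[of x] x u deg
    by (cases "pseudo_mod u h = 0") auto
  then show ?thesis using eq[of y] y a(1) by simp
qed

text \<open>
  The isomorphism between the fields generated by \<open>x\<close> and \<open>y\<close>. Writing the elements as quotients of
  integer polynomial values makes closure under inverses immediate.
\<close>

lemma field_graph_conjugates:
  fixes x y :: complex
  assumes conj: "\<And>u. poly (cpoly u) x = 0 \<longleftrightarrow> poly (cpoly u) y = 0"
  shows "\<exists>G. field_graph G \<and> (x, y) \<in> G"
proof -
  let ?v = "\<lambda>u. poly (cpoly u)"
  define G where "G = {(?v u x / ?v w x, ?v u y / ?v w y) | u w. ?v w x \<noteq> 0}"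
  have I: "(?v u x / ?v w x, ?v u y / ?v w y) \<in> G" if "?v w x \<noteq> 0" for u w
    using that unfolding G_def by blast
  have "field_graph G"
    unfolding field_graph_def
  proof (intro conjI allI impI)
    show "(1, 1) \<in> G" using I[of 1 1] by simp
  next
    fix a b c d assume "(a, b) \<in> G" "(c, d) \<in> G"
    then obtain u w u' w' where nz: "?v w x \<noteq> 0" "?v w' x \<noteq> 0"
      and eq: "a = ?v u x / ?v w x" "b = ?v u y / ?v w y" "c = ?v u' x / ?v w' x" "d = ?v u' y / ?v w' y"
      unfolding G_def by blast
    have ny: "?v w y \<noteq> 0" "?v w' y \<noteq> 0" using nz conj[of w] conj[of w'] by simp_all
    have ww: "?v (w * w') x \<noteq> 0" using nz by (simp add: poly_cpoly_mult)
    show "(a - c, b - d) \<in> G"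
      using I[OF ww, of "u * w' - u' * w"] nz ny
      by (simp add: eq poly_cpoly_mult poly_cpoly_diff diff_frac_eq)
    show "(a * c, b * d) \<in> G"
      using I[OF ww, of "u * u'"] by (simp add: eq poly_cpoly_mult)
  next
    fix a b assume "(a, b) \<in> G"
    then obtain u w where nz: "?v w x \<noteq> 0" and eq: "a = ?v u x / ?v w x" "b = ?v u y / ?v w y"
      unfolding G_def by blast
    show "(inverse a, inverse b) \<in> G"
    proof (cases "?v u x = 0")
      case True
      then have "a = 0" "b = 0" using conj[of u] eq by simp_all
      then show ?thesis using I[of 1 0] by simp
    next
      case False
      then show ?thesis using I[OF False, of w] by (simp add: eq)
    qed
  next
    fix b assume "(0, b) \<in> G"
    then obtain u w where "?v w x \<noteq> 0" "0 = ?v u x / ?v w x" "b = ?v u y / ?v w y"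
      unfolding G_def by blast
    then show "b = 0" using conj[of u] by simp
  qed
  moreover have "(x, y) \<in> G" using I[of 1 "[:0, 1:]"] by (simp add: map_poly_pCons)
  ultimately show ?thesis by blast
qed

text \<open>
  The shape \<open>x^N + 2 u\<close> with \<open>u\<close> of degree below \<open>N\<close> and odd constant coefficient is reproduced by
  \<open>f = x^2 - 2 g x + 2 b\<close>: the cross terms of the square are even, and the new constant
  coefficient is \<open>2 b\<close> modulo \<open>4\<close>.
\<close>

lemma shifted_square_iterate:
  fixes g c :: int
  assumes "g\<^sup>2 + c = 2 * b" "odd b"
  defines "f \<equiv> shifted_square g c"
  shows "\<exists>u. Polynomial.degree u < 2 ^ Suc k \<and> odd (poly.coeff u 0) \<and>
    (\<forall>z. poly (cpoly (Polynomial.monom 1 (2 ^ Suc k) + Polynomial.smult 2 u)) z = (poly (cpoly f) ^^ Suc k) z)"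
proof (induction k)
  case 0
  have "Polynomial.monom 1 2 + Polynomial.smult 2 [:b, - g:] = f"
    using assms(1) by (simp add: f_def shifted_square_def Polynomial.monom_altdef power2_eq_square)
  then show ?case using assms(2) by (intro exI[of _ "[:b, - g:]"]) simp
next
  case (Suc k)
  let ?N = "2 ^ Suc k :: nat"
  obtain u where u: "Polynomial.degree u < ?N" "odd (poly.coeff u 0)"
    and eq: "\<And>z. poly (cpoly (Polynomial.monom 1 ?N + Polynomial.smult 2 u)) z = (poly (cpoly f) ^^ Suc k) z"
    using Suc by blast
  define M where "M = (Polynomial.monom 1 ?N :: int poly)"
  define P where "P = M + Polynomial.smult 2 u"
  define u' where "u' = Polynomial.smult 2 (M * u + u * u) - Polynomial.smult g P + [:b:]"
  have degM: "Polynomial.degree M = ?N" by (simp add: M_def Polynomial.degree_monom_eq)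
  have "Polynomial.degree u' < 2 * ?N"
  proof -
    have "Polynomial.degree (M * u) < 2 * ?N" "Polynomial.degree (u * u) < 2 * ?N"
      using Polynomial.degree_mult_le[of M u] Polynomial.degree_mult_le[of u u] degM u(1) by linarith+
    moreover have "Polynomial.degree P < 2 * ?N"
      unfolding P_def by (rule Polynomial.degree_add_less) (use degM u(1) in auto)
    ultimately show ?thesis
      unfolding u'_def by (intro Polynomial.degree_add_less Polynomial.degree_diff_less) (auto simp: Polynomial.degree_smult_eq Polynomial.degree_add_less)
  qed
  moreover have "poly.coeff M 0 = 0" by (simp add: M_def)
  then have "odd (poly.coeff u' 0)"
    using assms(2) by (simp add: u'_def P_def Polynomial.coeff_mult_0)
  moreover have "poly (cpoly (Polynomial.monom 1 (2 * ?N) + Polynomial.smult 2 u')) z = (poly (cpoly f) ^^ Suc (Suc k)) z" for z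
  proof -
    have MM: "Polynomial.monom 1 (2 * ?N) = M * M"
      by (simp add: M_def Polynomial.mult_monom mult_2)
    have "(of_int c :: complex) = 2 * of_int b - (of_int g)\<^sup>2"
      using arg_cong[OF assms(1), of "of_int :: int \<Rightarrow> complex"] by (simp add: algebra_simps)
    then have "poly (cpoly (Polynomial.monom 1 (2 * ?N) + Polynomial.smult 2 u')) z = poly (cpoly f) (poly (cpoly P) z)"
      unfolding MM u'_def P_def f_def
      by (simp add: poly_cpoly_add poly_cpoly_diff poly_cpoly_mult poly_cpoly_smult poly_shifted_square map_poly_pCons power2_eq_square algebra_simps)
    then show ?thesis using eq[of z] by (simp add: P_def M_def)
  qed
  ultimately show ?case by (intro exI[of _ u']) (simp only: power_Suc[of 2 "Suc k"], blast)
qed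

lemma level_transitive:
  fixes g c :: int
  assumes "g\<^sup>2 + c = 2 * b" "odd b"
  defines "f \<equiv> shifted_square g c"
  shows "transitive_on (arboreal_galois f) (preimage_level f k)"
  unfolding transitive_on_def
proof (intro ballI)
  fix x y assume xy: "x \<in> preimage_level f k" "y \<in> preimage_level f k"
  have "poly (cpoly v) x = 0 \<longleftrightarrow> poly (cpoly v) y = 0" for v
  proof (cases k)
    case 0
    then show ?thesis using xy by (simp add: level_0)
  next
    case (Suc j)
    obtain u where u: "Polynomial.degree u < 2 ^ Suc j" "odd (poly.coeff u 0)"
      and eq: "\<And>z. poly (cpoly (Polynomial.monom 1 (2 ^ Suc j) + Polynomial.smult 2 u)) z = (poly (cpoly f) ^^ Suc j) z"
      using shifted_square_iterate[OF assms(1,2), of j] unfolding f_def by blast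
    define h where "h = Polynomial.monom 1 (2 ^ Suc j) + Polynomial.smult 2 u"
    have deg: "Polynomial.degree h = 2 ^ Suc j"
      unfolding h_def using u(1) by (subst Polynomial.degree_add_eq_left) (auto simp: Polynomial.degree_monom_eq)
    have "\<not> 4 dvd 2 * poly.coeff u 0" using u(2) by presburger
    then have "eisenstein 2 h"
      unfolding eisenstein_def deg using u(1)
      by (auto simp: h_def Polynomial.coeff_eq_0)
    moreover have "poly (cpoly h) x = 0" "poly (cpoly h) y = 0"
      using xy unfolding h_def eq Suc preimage_level_def by auto
    ultimately show ?thesis using eisenstein_conjugate by blast
  qed
  then obtain G where "field_graph G" "(x, y) \<in> G" using field_graph_conjugates by blast
  then obtain \<sigma> where s: "\<sigma> \<in> rat_galois_group (arboreal_field f)" and "\<sigma> x = y"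
    using galois_extension[of G g c] xy level_in_tree arboreal_field_incl(2) unfolding f_def by metis
  then have "restrict \<sigma> (preimage_tree f) x = y" using level_in_tree[OF xy(1)] by simp
  then show "\<exists>\<pi>\<in>arboreal_galois f. \<pi> x = y" using s unfolding arboreal_galois_def by blast
qed


section \<open>Cycles and the discriminants of the levels\<close>

lemma tree_critical_point:
  "no_critical_point (shifted_square g c) \<longleftrightarrow> of_int g \<notin> preimage_tree (shifted_square g c)"
proof -
  have "poly (pderiv (cpoly (shifted_square g c))) z = 0 \<longleftrightarrow> z = of_int g" for z
    by (auto simp: shifted_square_def map_poly_pCons pderiv_pCons)
  then show ?thesis by (auto simp: no_critical_point_def)
qed

text \<open>
  The preimages of a vertex \<open>y\<close> contribute \<open>(t - g)^2 - (y - c) = f t - y\<close> to the product, which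
  reduces level \<open>k + 1\<close> at \<open>t\<close> to level \<open>k\<close> at \<open>f t\<close>. They are distinct because \<open>g\<close> is not a
  vertex.
\<close>

lemma level_card_prod:
  fixes g c :: int
  assumes crit: "of_int g \<notin> preimage_tree (shifted_square g c)"
  defines "f \<equiv> shifted_square g c"
  shows "card (preimage_level f k) = 2 ^ k \<and>
    (\<forall>t. (\<Prod>z\<in>preimage_level f k. t - z) = (poly (cpoly f) ^^ k) t)"
proof (induction k)
  case 0
  show ?case by (simp add: level_0)
next
  case (Suc k)
  let ?L = "preimage_level f k" and ?F = "poly (cpoly f)"
  let ?r = "\<lambda>y. csqrt (y - of_int c)"
  let ?B = "\<lambda>y. {of_int g + ?r y, of_int g - ?r y}"
  have un: "preimage_level f (Suc k) = (\<Union>y\<in>?L. ?B y)"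
    unfolding f_def by (rule level_Suc_Union)
  have fin: "finite ?L" unfolding f_def by (rule finite_level)
  have B: "?F z = y" if "z \<in> ?B y" for z y
    using that unfolding f_def shifted_square_fibre by simp
  have disj: "\<forall>y\<in>?L. \<forall>y'\<in>?L. y \<noteq> y' \<longrightarrow> ?B y \<inter> ?B y' = {}"
  proof (intro ballI impI equals0I)
    fix y y' z assume "y \<noteq> y'" "z \<in> ?B y \<inter> ?B y'"
    then show False using B[of z y] B[of z y'] by simp
  qed
  have ne: "of_int g + ?r y \<noteq> of_int g - ?r y" if "y \<in> ?L" for y
  proof
    assume "of_int g + ?r y = of_int g - ?r y"
    then have "?r y + ?r y = 0" by (simp only: diff_conv_add_uminus add_left_cancel eq_neg_iff_add_eq_0)
    then have "?F (of_int g) = y" using B[of "of_int g" y] by simp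
    then have "of_int g \<in> preimage_level f (Suc k)" using that by (simp only: level_Suc_iff)
    then show False using crit level_in_tree unfolding f_def by metis
  qed
  have "card (preimage_level f (Suc k)) = (\<Sum>y\<in>?L. card (?B y))"
    unfolding un by (rule card_UN_disjoint[OF fin _ disj]) simp
  also have "\<dots> = (\<Sum>y\<in>?L. 2)" using ne by (intro sum.cong) auto
  finally have 1: "card (preimage_level f (Suc k)) = 2 ^ Suc k" using Suc by simp
  have "(\<Prod>z\<in>preimage_level f (Suc k). t - z) = (?F ^^ Suc k) t" for t
  proof -
    have "(\<Prod>z\<in>preimage_level f (Suc k). t - z) = (\<Prod>y\<in>?L. \<Prod>z\<in>?B y. t - z)"
      unfolding un by (rule prod.UNION_disjoint[OF fin _ disj]) simp
    also have "\<dots> = (\<Prod>y\<in>?L. ?F t - y)"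
    proof (rule prod.cong[OF refl])
      fix y assume y: "y \<in> ?L"
      have "(\<Prod>z\<in>?B y. t - z) = (t - of_int g)\<^sup>2 - (?r y)\<^sup>2"
        using ne[OF y] by (simp add: algebra_simps power2_eq_square)
      then show "(\<Prod>z\<in>?B y. t - z) = ?F t - y" by (simp add: f_def poly_shifted_square)
    qed
    also have "\<dots> = (?F ^^ Suc k) t" using Suc by (simp add: funpow_swap1)
    finally show ?thesis .
  qed
  with 1 show ?case by blast
qed

text \<open>
  The norm of \<open>y - c\<close>, where \<open>g\<close> plus a square root of \<open>y - c\<close> is a vertex above \<open>y\<close>. Up to sign and
  squares it is the discriminant of the iterate of order \<open>k + 1\<close>.
\<close>

definition level_disc :: "int \<Rightarrow> int \<Rightarrow> nat \<Rightarrow> complex" where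
  "level_disc g c k = (\<Prod>y\<in>preimage_level (shifted_square g c) k. y - of_int c)"

lemma level_disc_eq:
  assumes crit: "of_int g \<notin> preimage_tree (shifted_square g c)"
  shows "level_disc g c k = (- 1) ^ 2 ^ k * (poly (cpoly (shifted_square g c)) ^^ Suc k) (of_int g)"
proof -
  let ?f = "shifted_square g c"
  have "level_disc g c k = (\<Prod>y\<in>preimage_level ?f k. - 1 * (of_int c - y))"
    unfolding level_disc_def by (intro prod.cong) auto
  also have "\<dots> = (- 1) ^ 2 ^ k * (poly (cpoly ?f) ^^ k) (of_int c)"
    by (simp only: prod.distrib prod_constant level_card_prod[OF crit])
  also have "(poly (cpoly ?f) ^^ k) (of_int c) = (poly (cpoly ?f) ^^ Suc k) (of_int g)"
    unfolding funpow_Suc_right comp_apply by (simp add: poly_shifted_square)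
  finally show ?thesis .
qed

context
  fixes g c :: int and f \<sigma>
  defines f: "f \<equiv> shifted_square g c"
  assumes s: "\<sigma> \<in> rat_galois_group (arboreal_field f)"
begin

lemma pow_field: "x \<in> carrier (arboreal_field f) \<Longrightarrow> (\<sigma> ^^ i) x \<in> carrier (arboreal_field f)"
  by (induction i) (auto intro: galois_mem_field[OF s])

lemma pow_level: "x \<in> preimage_level f k \<Longrightarrow> (\<sigma> ^^ i) x \<in> preimage_level f k"
  using galois_level_iff[OF s] arboreal_field_incl(2) level_in_tree by (induction i) auto

lemma pow_poly:
  "x \<in> carrier (arboreal_field f) \<Longrightarrow> (\<sigma> ^^ i) (poly (cpoly h) x) = poly (cpoly h) ((\<sigma> ^^ i) x)"
  by (induction i) (auto simp: galois_poly[OF s pow_field])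

lemma pow_reflect:
  assumes "x \<in> carrier (arboreal_field f)"
  shows "(\<sigma> ^^ i) (2 * of_int g - x) = 2 * of_int g - (\<sigma> ^^ i) x"
  using pow_poly[OF assms, of i "[:2 * g, - 1:]"] by (simp add: map_poly_pCons)

lemma galois_prod:
  fixes N :: nat
  assumes "\<And>i. i < N \<Longrightarrow> h i \<in> carrier (arboreal_field f)"
  shows "(\<Prod>i<N. h i) \<in> carrier (arboreal_field f) \<and> \<sigma> (\<Prod>i<N. h i) = (\<Prod>i<N. \<sigma> (h i))"
  using assms
proof (induction N)
  case 0
  show ?case using rat_galois_groupD(2)[OF s] arboreal_field_incl(1) by simp
next
  case (Suc N)
  then show ?case using arboreal_field_closed(2) rat_galois_groupD(5)[OF s] by simp
qed

context
  assumes crit: "of_int g \<notin> preimage_tree f"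
begin

text \<open>
  Applying \<open>\<sigma>\<close> to \<open>R\<close> shifts the orbit of \<open>x\<close> by one step, so that the first factor \<open>x - g\<close> is
  replaced by \<open>\<sigma>^N x - g\<close>. As \<open>\<sigma>^N\<close> fixes the parent of \<open>x\<close>, that factor is \<open>x - g\<close> or \<open>g - x\<close>,
  and the sign is the effect of \<open>\<sigma>\<close> on the square root \<open>R\<close> of the discriminant.
\<close>

lemma sqrt_disc_monodromy:
  assumes x: "x \<in> preimage_level f (Suc k)"
    and bij: "bij_betw (\<lambda>i. (\<sigma> ^^ i) (poly (cpoly f) x)) {..<N} (preimage_level f k)"
  defines "R \<equiv> \<Prod>i<N. (\<sigma> ^^ i) x - of_int g"
  shows "R \<in> carrier (arboreal_field f)" "R \<noteq> 0" "R\<^sup>2 = level_disc g c k"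
    and "\<sigma> R * (x - of_int g) = R * ((\<sigma> ^^ N) x - of_int g)"
proof -
  have xK: "x \<in> carrier (arboreal_field f)" using x level_in_tree arboreal_field_incl(2) by blast
  have lin: "u - of_int g = poly (cpoly [:- g, 1:]) u" for u by (simp add: map_poly_pCons)
  have K: "(\<sigma> ^^ i) x - of_int g \<in> carrier (arboreal_field f)"
    and shift: "\<sigma> ((\<sigma> ^^ i) x - of_int g) = (\<sigma> ^^ Suc i) x - of_int g" for i
    unfolding lin using poly_of_int_in_field galois_poly[OF s] pow_field[OF xK] by auto
  show "R \<in> carrier (arboreal_field f)" unfolding R_def using galois_prod[of N "\<lambda>i. (\<sigma> ^^ i) x - of_int g"] K by simp
  show "R \<noteq> 0" 
  proof -
    have "(\<sigma> ^^ i) x \<noteq> of_int g" for i using level_in_tree[OF pow_level[OF x]] crit by metis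
    then show ?thesis by (simp add: R_def)
  qed
  have "R\<^sup>2 = (\<Prod>i<N. ((\<sigma> ^^ i) x - of_int g)\<^sup>2)" unfolding R_def by (rule prod_power_distrib)
  also have "\<dots> = (\<Prod>i<N. (\<sigma> ^^ i) (poly (cpoly f) x) - of_int c)"
    by (simp only: pow_poly[OF xK]) (simp add: f poly_shifted_square)
  also have "\<dots> = level_disc g c k"
    unfolding level_disc_def f[symmetric] by (rule prod.reindex_bij_betw[OF bij])
  finally show "R\<^sup>2 = level_disc g c k" .
  have "\<sigma> R = (\<Prod>i<N. (\<sigma> ^^ Suc i) x - of_int g)"
    unfolding R_def using galois_prod[of N "\<lambda>i. (\<sigma> ^^ i) x - of_int g"] K shift by simp
  then have "\<sigma> R * (x - of_int g) = (\<Prod>i<Suc N. (\<sigma> ^^ i) x - of_int g)"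
    by (simp only: prod.lessThan_Suc_shift) (simp add: mult.commute)
  then show "\<sigma> R * (x - of_int g) = R * ((\<sigma> ^^ N) x - of_int g)" by (simp add: R_def)
qed

text \<open>
  By induction the parent \<open>f x\<close> has an orbit of length \<open>2^k\<close> filling level \<open>k\<close>. As the square root
  of \<open>level_disc k\<close> is negated, \<open>\<sigma>^(2^k)\<close> sends \<open>x\<close> to its sibling, and the orbit of \<open>x\<close> covers both
  preimages of every vertex of level \<open>k\<close>.
\<close>

lemma transitive_orbit_if_discs_negated:
  assumes neg: "\<And>j w. j < k \<Longrightarrow> w \<in> carrier (arboreal_field f) \<Longrightarrow> w\<^sup>2 = level_disc g c j \<Longrightarrow> \<sigma> w = - w"
    and "x \<in> preimage_level f k"
  shows "bij_betw (\<lambda>i. (\<sigma> ^^ i) x) {..<2 ^ k} (preimage_level f k) \<and> (\<sigma> ^^ 2 ^ k) x = x"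
  using assms
proof (induction k arbitrary: x)
  case 0
  then show ?case using rat_galois_groupD(2)[OF s, of 0] by (simp add: level_0 bij_betw_def lessThan_Suc)
next
  case (Suc k)
  let ?N = "2 ^ k :: nat" and ?F = "poly (cpoly f)"
  have xK: "x \<in> carrier (arboreal_field f)"
    by (intro arboreal_field_incl(2) level_in_tree[OF Suc.prems(2)])
  have y: "?F x \<in> preimage_level f k" using Suc.prems(2) by (simp only: level_Suc_iff)
  have bij: "bij_betw (\<lambda>i. (\<sigma> ^^ i) (?F x)) {..<?N} (preimage_level f k)"
    by (rule conjunct1[OF Suc.IH[OF Suc.prems(1) y]]) simp_all
  note R = sqrt_disc_monodromy[OF Suc.prems(2) bij]
  have "(\<sigma> ^^ ?N) x - of_int g = - (x - of_int g)"
    using R(4) unfolding Suc.prems(1)[OF lessI R(1) R(3)] mult_minus_left mult_minus_right[symmetric]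
      mult_left_cancel[OF R(2)] by (rule sym)
  then have half: "(\<sigma> ^^ ?N) x = 2 * of_int g - x" by (simp add: algebra_simps)
  have refl: "(\<sigma> ^^ (i + ?N)) x = 2 * of_int g - (\<sigma> ^^ i) x" for i
    by (simp add: funpow_add half pow_reflect[OF xK])
  have "preimage_level f (Suc k) \<subseteq> (\<lambda>i. (\<sigma> ^^ i) x) ` {..<2 ^ Suc k}"
  proof
    fix z assume "z \<in> preimage_level f (Suc k)"
    then have "?F z \<in> preimage_level f k" using level_Suc_iff by blast
    then have "?F z \<in> (\<lambda>i. (\<sigma> ^^ i) (?F x)) ` {..<?N}" using bij by (simp add: bij_betw_def)
    then obtain i where i: "i < ?N" "?F z = ?F ((\<sigma> ^^ i) x)"
      unfolding pow_poly[OF xK] by blast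
    then have "(z - of_int g)\<^sup>2 = ((\<sigma> ^^ i) x - of_int g)\<^sup>2" by (simp add: f poly_shifted_square)
    then have "z = (\<sigma> ^^ i) x \<or> z = (\<sigma> ^^ (i + ?N)) x"
      unfolding refl power2_eq_iff by (auto simp: algebra_simps)
    then show "z \<in> (\<lambda>i. (\<sigma> ^^ i) x) ` {..<2 ^ Suc k}" using i(1) by auto
  qed
  moreover have "(\<lambda>i. (\<sigma> ^^ i) x) ` {..<2 ^ Suc k} \<subseteq> preimage_level f (Suc k)"
    using pow_level[OF Suc.prems(2)] by blast
  ultimately have im: "(\<lambda>i. (\<sigma> ^^ i) x) ` {..<2 ^ Suc k} = preimage_level f (Suc k)" by blast
  moreover have "card (preimage_level f (Suc k)) = 2 ^ Suc k"
    using level_card_prod crit unfolding f by blast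
  ultimately have "inj_on (\<lambda>i. (\<sigma> ^^ i) x) {..<2 ^ Suc k}"
    by (intro eq_card_imp_inj_on) simp_all
  moreover have "(\<sigma> ^^ 2 ^ Suc k) x = x"
    unfolding power_Suc mult_2 refl half by simp
  ultimately show ?case using im by (simp add: bij_betw_def)
qed

text \<open>
  An orbit of \<open>x\<close> filling level \<open>k + 1\<close> contains the sibling of \<open>x\<close>, necessarily half-way, so the
  parent has an orbit of length \<open>2^k\<close>. The square root of the discriminant is then negated, which
  is impossible for a rational number.
\<close>

lemma no_transitive_orbit_if_disc_square:
  assumes x: "x \<in> preimage_level f (Suc k)"
    and inj: "inj_on (\<lambda>i. (\<sigma> ^^ i) x) {..<2 ^ Suc k}" and per: "(\<sigma> ^^ 2 ^ Suc k) x = x"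
    and disc: "level_disc g c k = r\<^sup>2" and r: "r \<in> \<rat>"
  shows False
proof -
  let ?N = "2 ^ k :: nat" and ?F = "poly (cpoly f)"
  let ?o = "\<lambda>i. (\<sigma> ^^ i) x"
  have xK: "x \<in> carrier (arboreal_field f)" using x level_in_tree arboreal_field_incl(2) by blast
  have card: "card (preimage_level f j) = 2 ^ j" for j using level_card_prod crit unfolding f by blast
  have fin: "finite (preimage_level f j)" for j unfolding f by (rule finite_level)
  have neq: "?o i \<noteq> ?o j" if "i < j" "j < 2 * ?N" for i j
    using inj_onD[OF inj, of i j] that by auto
  have "?o ` {..<2 ^ Suc k} = preimage_level f (Suc k)"
    by (rule card_subset_eq[OF fin]) (use pow_level[OF x] card card_image[OF inj] in auto)
  moreover have "2 * of_int g - x \<in> preimage_level f (Suc k)"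
    using x by (simp add: level_Suc_iff f poly_shifted_square power2_commute)
  ultimately obtain m where m: "m < 2 * ?N" "?o m = 2 * of_int g - x" by force
  have "x \<noteq> of_int g" using x crit level_in_tree by blast
  have "m \<noteq> 0"
  proof
    assume "m = 0"
    then have "2 * x = 2 * of_int g" using m(2) by simp
    then show False using \<open>x \<noteq> of_int g\<close> by simp
  qed
  have "?o (m + m) = x" using m(2) pow_reflect[OF xK, of m] by (simp add: funpow_add)
  \<comment> \<open>The sibling map commutes with \<open>\<sigma>\<close>, so \<open>2 m\<close> is a period of \<open>x\<close>.\<close>
  have "m = ?N"
  proof (rule ccontr)
    assume "m \<noteq> ?N"
    then consider "2 * m < 2 * ?N" | "2 * ?N < 2 * m" by linarith
    then show False
    proof cases
      case 1
      then show False using neq[of 0 "m + m"] \<open>m \<noteq> 0\<close> \<open>?o (m + m) = x\<close> by simp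
    next
      case 2
      have "?o (m + m) = ?o (2 * m - 2 * ?N + 2 * ?N)" using 2 by (simp add: mult_2)
      also have "\<dots> = ?o (2 * m - 2 * ?N)" unfolding funpow_add using per by simp
      finally have "?o (2 * m - 2 * ?N) = x" using \<open>?o (m + m) = x\<close> by simp
      moreover have "0 < 2 * m - 2 * ?N" "2 * m - 2 * ?N < 2 * ?N" using 2 m(1) by linarith+
      ultimately show False using neq[of 0 "2 * m - 2 * ?N"] by simp
    qed
  qed
  then have half: "?o ?N = 2 * of_int g - x" using m(2) by simp
  have "inj_on (\<lambda>i. (\<sigma> ^^ i) (?F x)) {..<?N}"
  proof (rule linorder_inj_onI)
    fix i j assume ij: "i < j" "i \<in> {..<?N}" "j \<in> {..<?N}"
    show "(\<sigma> ^^ i) (?F x) \<noteq> (\<sigma> ^^ j) (?F x)"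
    proof
      assume "(\<sigma> ^^ i) (?F x) = (\<sigma> ^^ j) (?F x)"
      then have "(?o j - of_int g)\<^sup>2 = (?o i - of_int g)\<^sup>2"
        unfolding pow_poly[OF xK] by (simp add: f poly_shifted_square)
      then have "?o j = ?o i \<or> ?o j = 2 * of_int g - ?o i"
        unfolding power2_eq_iff by (auto simp: algebra_simps)
      moreover have "2 * of_int g - ?o i = ?o (i + ?N)"
        by (simp add: funpow_add half pow_reflect[OF xK])
      ultimately show False using neq[of i j] neq[of j "i + ?N"] ij by auto
    qed
  qed auto
  moreover have "(\<lambda>i. (\<sigma> ^^ i) (?F x)) ` {..<?N} \<subseteq> preimage_level f k"
    using pow_level x level_Suc_iff by blast
  ultimately have bij: "bij_betw (\<lambda>i. (\<sigma> ^^ i) (?F x)) {..<?N} (preimage_level f k)"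
    unfolding bij_betw_def using card_subset_eq[OF fin] card card_image by (metis card_lessThan)
  note R = sqrt_disc_monodromy[OF x bij]
  let ?R = "\<Prod>i<?N. ?o i - of_int g"
  have "?R \<in> \<rat>" using R(3) r unfolding disc power2_eq_iff by auto
  then have "?o ?N = x" using R(2,4) rat_galois_groupD(2)[OF s] by simp
  then show False using neq[of 0 ?N] by simp
qed

end

end

lemma cycle_of_list_nth:
  assumes "distinct cs" "i < length cs"
  shows "cycle_of_list cs (cs ! i) = cs ! (Suc i mod length cs)"
proof -
  have "map (cycle_of_list cs) cs = rotate1 cs"
    using cyclic_rotation[OF assms(1), of "Suc 0"] by (simp add: rotate_def)
  from arg_cong[OF this, of "\<lambda>l. l ! i"] show ?thesis using assms(2) by (simp add: nth_rotate1)
qed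

lemma acts_as_cycleI:
  assumes bij: "bij_betw (\<lambda>i. (\<sigma> ^^ i) x) {..<m} S" and per: "(\<sigma> ^^ m) x = x"
  shows "acts_as_cycle \<sigma> m S"
proof -
  define cs where "cs = map (\<lambda>i. (\<sigma> ^^ i) x) [0..<m]"
  have "distinct cs"
    using bij by (simp add: cs_def distinct_map bij_betw_def atLeast0LessThan)
  moreover have "set cs = S" using bij by (simp add: cs_def bij_betw_def atLeast0LessThan)
  moreover have "\<sigma> z = cycle_of_list cs z" if "z \<in> S" for z
  proof -
    from that bij obtain i where i: "i < m" "z = (\<sigma> ^^ i) x" by (auto simp: bij_betw_def)
    have "cycle_of_list cs (cs ! i) = cs ! (Suc i mod m)"
      using cycle_of_list_nth[OF \<open>distinct cs\<close>, of i] i by (simp add: cs_def)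
    also have "\<dots> = \<sigma> z"
    proof (cases "Suc i = m")
      case True
      then show ?thesis using i per by (auto simp: cs_def)
    qed (use i in \<open>simp add: cs_def\<close>)
    finally show ?thesis using i by (simp add: cs_def)
  qed
  ultimately show ?thesis unfolding acts_as_cycle_def by (intro exI[of _ cs]) (auto simp: cs_def)
qed

lemma acts_as_cycleE:
  assumes "acts_as_cycle \<sigma> m S" "0 < m"
  obtains x where "x \<in> S" "inj_on (\<lambda>i. (\<sigma> ^^ i) x) {..<m}" "(\<sigma> ^^ m) x = x"
proof -
  obtain cs where cs: "distinct cs" "length cs = m" "set cs \<subseteq> S"
    and eq: "\<And>x. x \<in> S \<Longrightarrow> \<sigma> x = cycle_of_list cs x"
    using assms(1) unfolding acts_as_cycle_def by blast
  have pow: "(\<sigma> ^^ i) (cs ! 0) = cs ! (i mod m)" for i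
  proof (induction i)
    case 0
    show ?case by simp
  next
    case (Suc i)
    have m: "i mod m < m" using assms(2) by simp
    then have "cycle_of_list cs (cs ! (i mod m)) = cs ! (Suc i mod m)"
      using cycle_of_list_nth[OF cs(1)] cs(2) by (simp add: mod_Suc_eq)
    moreover have "cs ! (i mod m) \<in> S" using m cs(2,3) nth_mem by blast
    ultimately show ?case using Suc eq by simp
  qed
  show ?thesis
  proof (rule that)
    show "cs ! 0 \<in> S" using cs assms(2) by auto
    show "inj_on (\<lambda>i. (\<sigma> ^^ i) (cs ! 0)) {..<m}"
      unfolding pow using cs by (auto simp: inj_on_def nth_eq_iff_index_eq)
    show "(\<sigma> ^^ m) (cs ! 0) = cs ! 0" by (simp add: pow)
  qed
qed


section \<open>Automorphisms with prescribed signs on square roots\<close>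

text \<open>
  Kummer theory for two disjoint sets \<open>A\<close> and \<open>B\<close> of rational numbers that multiply like the signs
  \<open>1\<close> and \<open>- 1\<close>. The square roots of elements of \<open>B\<close> are adjoined one at a time and negated. The
  invariant (\<open>good\<close>) is that every element whose square is rational is fixed or negated according
  to the class of its square; it guarantees that a square root which is already present has
  been negated. It persists because an element \<open>a + b w\<close>, where \<open>w\<close> is new, has a rational square
  only if \<open>a = 0\<close> or \<open>b = 0\<close>.
\<close>

lemma sign_field_graph:
  fixes A B :: "complex set"
  assumes squares: "\<And>q. q \<in> \<rat> \<Longrightarrow> q \<noteq> 0 \<Longrightarrow> q\<^sup>2 \<in> A"
    and AB: "\<And>a b. a \<in> A \<Longrightarrow> b \<in> B \<Longrightarrow> a * b \<in> B"
    and BB: "\<And>a b. a \<in> B \<Longrightarrow> b \<in> B \<Longrightarrow> a * b \<in> A"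
    and disj: "A \<inter> B = {}" and rat: "B \<subseteq> \<rat>"
    and D: "finite D" "D \<subseteq> B"
  shows "\<exists>G. field_graph G \<and> (\<forall>d\<in>D. \<forall>w. w\<^sup>2 = d \<longrightarrow> (w, - w) \<in> G)"
proof -
  define good where "good G \<longleftrightarrow> field_graph G \<and> (\<forall>r s. (r, s) \<in> G \<longrightarrow> r \<noteq> 0 \<longrightarrow> r\<^sup>2 \<in> \<rat> \<longrightarrow>
      r\<^sup>2 \<in> A \<and> s = r \<or> r\<^sup>2 \<in> B \<and> s = - r)" for G
  have "\<exists>G. good G \<and> (\<forall>d\<in>D. \<forall>w. w\<^sup>2 = d \<longrightarrow> (w, - w) \<in> G)"
    using D
  proof (induction D rule: finite_induct)
    case empty
    let ?Q = "{(q, q) | q :: complex. q \<in> \<rat>}"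
    have "good ?Q"
      unfolding good_def field_graph_def using squares by auto
    then show ?case by blast
  next
    case (insert d D)
    then obtain G where G: "field_graph G"
      and inv: "\<And>r s. (r, s) \<in> G \<Longrightarrow> r \<noteq> 0 \<Longrightarrow> r\<^sup>2 \<in> \<rat> \<Longrightarrow> r\<^sup>2 \<in> A \<and> s = r \<or> r\<^sup>2 \<in> B \<and> s = - r"
      and old: "\<And>d w. d \<in> D \<Longrightarrow> w\<^sup>2 = d \<Longrightarrow> (w, - w) \<in> G"
      unfolding good_def by auto
    have good: "good G" using G inv unfolding good_def by blast
    have dB: "d \<in> B" and dQ: "d \<in> \<rat>" using insert.prems rat by auto
    have "d \<noteq> 0"
    proof
      assume "d = 0"
      then have "d * d = d" by simp
      then show False using BB[OF dB dB] dB disj by auto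
    qed
    define w where "w = csqrt d"
    have w: "w\<^sup>2 = d" "w \<noteq> 0" using \<open>d \<noteq> 0\<close> by (auto simp: w_def)
    have "\<exists>H. good H \<and> G \<subseteq> H \<and> (w, - w) \<in> H"
    proof (cases "w \<in> Domain G")
      case True
      then obtain s where s: "(w, s) \<in> G" by blast
      then have "s = - w" using inv[OF s] w dQ dB disj by auto
      then show ?thesis using s good by blast
    next
      case False
      let ?H = "adjoin G w (- w)"
      have sq: "(w\<^sup>2, (- w)\<^sup>2) \<in> G" using w fg_Rats[OF G dQ] by simp
      have "r\<^sup>2 \<in> A \<and> s = r \<or> r\<^sup>2 \<in> B \<and> s = - r"
        if rs: "(r, s) \<in> ?H" "r \<noteq> 0" "r\<^sup>2 \<in> \<rat>" for r s
      proof -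
        obtain a b a' b' where ab: "(a, a') \<in> G" "(b, b') \<in> G"
          and r: "r = a + b * w" and s: "s = a' + b' * (- w)"
          using rs(1) unfolding adjoin_def by blast
        show ?thesis
        proof (cases "b = 0")
          case True
          then have "b' = 0" using fg_zeroD[OF G] ab(2) by blast
          then show ?thesis using True r s inv[OF ab(1)] rs(2,3) by simp
        next
          case b: False
          have "a = 0"
          proof (rule ccontr)
            assume "a \<noteq> 0"
            have "(r\<^sup>2 - a\<^sup>2 - b\<^sup>2 * w\<^sup>2) / (2 * a * b) = w"
              using \<open>a \<noteq> 0\<close> b unfolding r by (simp add: field_simps power2_eq_square)
            moreover have "(r\<^sup>2 - a\<^sup>2 - b\<^sup>2 * w\<^sup>2) / (2 * a * b) \<in> Domain G"
              using fg_divide[OF G fg_diff[OF G fg_diff[OF G fg_Rats[OF G rs(3)] fg_square[OF G ab(1)]]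
                    fg_mult[OF G fg_square[OF G ab(2)] sq]]
                  fg_mult[OF G fg_mult[OF G fg_Rats[OF G, of 2] ab(1)] ab(2)]] by auto
            ultimately show False using False by simp
          qed
          then have "a' = 0" using fg_zeroD[OF G] ab(1) by blast
          have r2: "r\<^sup>2 = b\<^sup>2 * d" using \<open>a = 0\<close> r w(1) by (simp add: power_mult_distrib)
          then have "b\<^sup>2 = r\<^sup>2 / d" using \<open>d \<noteq> 0\<close> by simp
          then have "b\<^sup>2 \<in> \<rat>" using rs(3) dQ by simp
          then consider "b\<^sup>2 \<in> A" "b' = b" | "b\<^sup>2 \<in> B" "b' = - b" using inv[OF ab(2) b] by blast
          then show ?thesis
            using AB[OF _ dB] BB[OF _ dB] unfolding r2 by cases (simp_all add: r s \<open>a = 0\<close> \<open>a' = 0\<close>)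
        qed
      qed
      then have "good ?H" using field_graph_adjoin[OF G False sq] unfolding good_def by blast
      then show ?thesis using adjoin_subset[OF G] adjoin_generator[OF G] by blast
    qed
    then obtain H where H: "good H" "G \<subseteq> H" "(w, - w) \<in> H" by blast
    then have "(- w, w) \<in> H" using fg_uminus[of H w "- w"] unfolding good_def by simp
    have "(v, - v) \<in> H" if "v\<^sup>2 = d" for v
    proof -
      have "v = w \<or> v = - w" using that w(1) by (simp add: power2_eq_iff[symmetric])
      then show ?thesis using H(3) \<open>(- w, w) \<in> H\<close> by auto
    qed
    then show ?case using H(1,2) old by blast
  qed
  then show ?thesis unfolding good_def by blast
qed

text \<open>
  Modulo squares, the rational numbers of even valuation at \<open>2\<close>, sorted by the residue modulo \<open>4\<close> of
  the absolute value of an odd representative (for odd \<open>k\<close>). Signs are disregarded because the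
  discriminant of level \<open>0\<close> is positive and those of the following levels are negative.
\<close>

definition odd_class :: "nat \<Rightarrow> complex set" where
  "odd_class k = {of_int s * of_nat a * t\<^sup>2 | s a t. (s = 1 \<or> s = - 1) \<and> a mod 4 = k \<and> t \<in> \<rat> \<and> t \<noteq> 0}"

lemma odd_class_mult:
  assumes "x \<in> odd_class j" "y \<in> odd_class k"
  shows "x * y \<in> odd_class (j * k mod 4)"
proof -
  obtain s a t s' a' t' where x: "x = of_int s * of_nat a * t\<^sup>2" "s = 1 \<or> s = - 1" "a mod 4 = j" "t \<in> \<rat>" "t \<noteq> 0"
    and y: "y = of_int s' * of_nat a' * t'\<^sup>2" "s' = 1 \<or> s' = - 1" "a' mod 4 = k" "t' \<in> \<rat>" "t' \<noteq> 0"
    using assms unfolding odd_class_def by blast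
  have "x * y = of_int (s * s') * of_nat (a * a') * (t * t')\<^sup>2"
    by (simp add: x(1) y(1) power_mult_distrib)
  moreover have "s * s' = 1 \<or> s * s' = - 1" using x(2) y(2) by auto
  moreover have "a * a' mod 4 = j * k mod 4" using x(3) y(3) by (metis mod_mult_eq)
  ultimately show ?thesis
    unfolding odd_class_def using x(4,5) y(4,5)
    by (intro CollectI exI[of _ "s * s'"] exI[of _ "a * a'"] exI[of _ "t * t'"] conjI) simp_all
qed

lemma odd_class_Rats: "odd_class k \<subseteq> \<rat>"
  by (auto simp: odd_class_def)

text \<open>
  If the classes met, then \<open>p^2 a = q^2 a'\<close> for coprime \<open>p\<close> and \<open>q\<close>, with \<open>a\<close> and \<open>a'\<close> congruent to
  \<open>1\<close> and \<open>3\<close> modulo \<open>4\<close>. Comparing parities, \<open>p\<close> and \<open>q\<close> are both odd, so their squares are \<open>1\<close>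
  modulo \<open>4\<close>.
\<close>

lemma odd_class_disjoint: "odd_class 1 \<inter> odd_class 3 = {}"
proof (rule ccontr)
  assume "odd_class 1 \<inter> odd_class 3 \<noteq> {}"
  then obtain x where "x \<in> odd_class 1" "x \<in> odd_class 3" by blast
  then obtain s a t s' a' t' where x: "x = of_int s * of_nat a * t\<^sup>2" "s = 1 \<or> s = - 1" "a mod 4 = 1" "t \<in> \<rat>" "t \<noteq> 0"
    and y: "x = of_int s' * of_nat a' * t'\<^sup>2" "s' = 1 \<or> s' = - 1" "a' mod 4 = 3" "t' \<in> \<rat>" "t' \<noteq> 0"
    unfolding odd_class_def by blast
  have "t / t' \<in> \<rat>" using x(4) y(4) by simp
  then obtain p q :: int where pq: "q > 0" "coprime p q" "t / t' = of_int p / of_int q"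
    by (rule Rats_cases')
  have "of_int (p\<^sup>2 * s * int a) = (of_int (q\<^sup>2 * s' * int a') :: complex)"
  proof -
    have "(t / t')\<^sup>2 * (of_int s * of_nat a) = of_int s' * of_nat a'"
      using x(1) y(1,5) by (simp add: power_divide field_simps)
    then show ?thesis unfolding pq(3) using pq(1) by (simp add: power_divide field_simps)
  qed
  then have eq: "p\<^sup>2 * s * int a = q\<^sup>2 * s' * int a'" unfolding of_int_eq_iff .
  then have "\<bar>p\<^sup>2 * s * int a\<bar> = \<bar>q\<^sup>2 * s' * int a'\<bar>" by simp
  then have eq: "p\<^sup>2 * int a = q\<^sup>2 * int a'" using x(2) y(2) by (auto simp: abs_mult)
  have a: "int a mod 4 = 1" "int a' mod 4 = 3" using x(3) y(3) by presburger+
  then have "odd (int a)" "odd (int a')" by presburger+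
  then have "even p \<longleftrightarrow> even q" using eq by (metis even_mult_iff even_power zero_less_numeral)
  moreover have "\<not> (even p \<and> even q)" using pq(2) by (metis coprime_common_divisor odd_one)
  ultimately have odd: "odd p" "odd q" by blast+
  have sq: "z\<^sup>2 mod 4 = 1" if "odd z" for z :: int
  proof -
    from that obtain m where "z = 2 * m + 1" by (rule oddE)
    then have "z\<^sup>2 = 4 * (m\<^sup>2 + m) + 1" by (simp add: power2_eq_square algebra_simps)
    moreover have "(4 * k + 1) mod 4 = 1" for k :: int by presburger
    ultimately show ?thesis by (simp only:)
  qed
  have "p\<^sup>2 * int a mod 4 = 1" "q\<^sup>2 * int a' mod 4 = 3"
    unfolding mod_mult_eq[of "p\<^sup>2" 4, symmetric] mod_mult_eq[of "q\<^sup>2" 4, symmetric] a sq[OF odd(1)] sq[OF odd(2)]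
    by simp_all
  then show False using eq by simp
qed


section \<open>A critical orbit with one square value\<close>

text \<open>
  The orbit of the critical point of \<open>y^2 + 4\<close>. The constant \<open>4\<close> makes all terms divisible by \<open>4\<close>
  and the orbit increasing, which gives the critical values below level \<open>n\<close> their sign and residue.
\<close>

fun crit_orbit :: "nat \<Rightarrow> int" where
  "crit_orbit 0 = 0"
| "crit_orbit (Suc k) = (crit_orbit k)\<^sup>2 + 4"

lemma crit_orbit_dvd: "4 dvd crit_orbit k"
  by (induction k) (auto simp: power2_eq_square)

lemma crit_orbit_ge: "crit_orbit k + 4 \<le> crit_orbit (Suc k)"
proof -
  have "x \<le> x\<^sup>2" for x :: int
    by (cases "x \<le> 0") (auto simp: power2_eq_square intro: order_trans[OF _ zero_le_square] mult_le_cancel_right1)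
  then show ?thesis by simp
qed

lemma crit_orbit_strict_mono:
  assumes "j < k" shows "crit_orbit j + 4 \<le> crit_orbit k"
  using assms
proof (induction k)
  case (Suc k)
  then show ?case using crit_orbit_ge[of k] by (cases "j = k") auto
qed simp

lemma iterate_critical_point:
  "(poly (cpoly (shifted_square g (g + 4))) ^^ k) (of_int g) = of_int (g + crit_orbit k)"
  by (induction k) (simp_all add: poly_shifted_square)

theorem theorem1p2:
  fixes n :: nat
  assumes "n \<ge> 2"
  shows "\<exists>f :: int poly. Polynomial.degree f = 2 \<and> no_critical_point f \<and>
           (\<forall>k. transitive_on (arboreal_galois f) (preimage_level f k)) \<and>
           (\<exists>\<pi> \<in> arboreal_galois f. acts_as_cycle \<pi> (2 ^ (n - 1)) (preimage_level f (n - 1))) \<and>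
           \<not> (\<exists>\<pi> \<in> arboreal_galois f. acts_as_cycle \<pi> (2 ^ n) (preimage_level f n))"
proof -
  define g where "g = 1 - crit_orbit n"
  define c where "c = g + 4"
  define f where "f = shifted_square g c"
  obtain m where n: "n = Suc (Suc m)" using assms by (metis One_nat_def Suc_1 Suc_le_D Suc_le_mono)
  have iter: "(poly (cpoly f) ^^ k) (of_int g) = of_int (1 - (crit_orbit n - crit_orbit k))" for k
    unfolding f_def c_def iterate_critical_point by (simp add: g_def)
  have crit: "of_int g \<notin> preimage_tree f"
  proof
    assume "of_int g \<in> preimage_tree f"
    then obtain k where "(poly (cpoly f) ^^ k) (of_int g) = 0"
      by (auto simp: preimage_tree_def preimage_level_def)
    then have "crit_orbit n - crit_orbit k = 1" unfolding iter of_int_eq_0_iff by simp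
    moreover have "4 dvd crit_orbit n - crit_orbit k" by (intro dvd_diff crit_orbit_dvd)
    ultimately show False by simp
  qed
  have disc: "level_disc g c k = (- 1) ^ 2 ^ k * of_int (1 - (crit_orbit n - crit_orbit (Suc k)))" for k
    unfolding iter[symmetric] using level_disc_eq[of g c k] crit unfolding f_def by simp
  \<comment> \<open>The constant coefficient of \<open>f\<close> is \<open>2\<close> modulo \<open>4\<close>.\<close>
  have "\<exists>b. g\<^sup>2 + c = 2 * b \<and> odd b"
  proof -
    obtain e where "crit_orbit n = 4 * e" using crit_orbit_dvd by blast
    then have "g\<^sup>2 + c = 2 * (2 * (4 * e\<^sup>2 - 3 * e + 1) + 1)"
      by (simp add: g_def c_def power2_eq_square algebra_simps)
    then show ?thesis by (metis odd_two_times_div_two_succ even_mult_iff odd_one even_add dvd_refl)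
  qed
  then have trans: "transitive_on (arboreal_galois f) (preimage_level f k)" for k
    unfolding f_def using level_transitive by blast
  have root: "\<exists>x. x \<in> preimage_level f k" for k
  proof -
    have "card (preimage_level f k) \<noteq> 0" using level_card_prod[of g c k] crit unfolding f_def by simp
    then show ?thesis by (metis card.empty ex_in_conv)
  qed
  have pow: "(restrict \<sigma> (preimage_tree f) ^^ i) x = (\<sigma> ^^ i) x"
    if "\<sigma> \<in> rat_galois_group (arboreal_field f)" "x \<in> preimage_level f k" for \<sigma> x i k
    using level_in_tree[OF pow_level[of \<sigma> g c x k]] that unfolding f_def by (induction i) auto

  have cyc: "\<exists>\<pi> \<in> arboreal_galois f. acts_as_cycle \<pi> (2 ^ (n - 1)) (preimage_level f (n - 1))"
  proof -
    let ?D = "level_disc g c ` {..<n - 1}"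
    have "level_disc g c k \<in> odd_class 3" if "k < n - 1" for k
    proof -
      \<comment> \<open>Up to sign, the discriminant is \<open>?a\<close>, a positive integer congruent to \<open>3\<close> modulo \<open>4\<close>.\<close>
      let ?a = "crit_orbit n - crit_orbit (Suc k) - 1"
      have "Suc k < n" using that by simp
      from crit_orbit_strict_mono[OF this] have "?a > 0" by linarith
      have "4 dvd crit_orbit n - crit_orbit (Suc k)" by (intro dvd_diff crit_orbit_dvd)
      then have "?a mod 4 = 3" by presburger
      then have "nat ?a mod 4 = 3" 
        using nat_mod_distrib[of ?a 4] \<open>?a > 0\<close> by (simp del: crit_orbit.simps)
      moreover have "level_disc g c k = of_int ((- 1) ^ 2 ^ k * - 1) * of_nat (nat ?a) * 1\<^sup>2"
        using \<open>?a > 0\<close> unfolding disc by (simp add: algebra_simps)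
      moreover have "((- 1) ^ 2 ^ k * - 1 :: int) = 1 \<or> ((- 1) ^ 2 ^ k * - 1 :: int) = - 1"
        by (cases k) auto
      ultimately show ?thesis
        unfolding odd_class_def
        by (intro CollectI exI[of _ "(- 1) ^ 2 ^ k * - 1"] exI[of _ "nat ?a"] exI[of _ 1] conjI)
          (assumption | simp only: Rats_1 one_neq_zero not_False_eq_True)+
    qed
    then have D: "?D \<subseteq> odd_class 3" by blast
    have sq: "q\<^sup>2 \<in> odd_class 1" if "q \<in> \<rat>" "q \<noteq> 0" for q
      unfolding odd_class_def using that by (intro CollectI exI[of _ 1] exI[of _ "1 :: nat"] exI[of _ q]) simp
    have "a * b \<in> odd_class 3" if "a \<in> odd_class 1" "b \<in> odd_class 3" for a b
      using odd_class_mult[OF that] by simp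
    moreover have "a * b \<in> odd_class 1" if "a \<in> odd_class 3" "b \<in> odd_class 3" for a b
      using odd_class_mult[OF that] by simp
    ultimately obtain G where G: "field_graph G" "\<And>d w. d \<in> ?D \<Longrightarrow> w\<^sup>2 = d \<Longrightarrow> (w, - w) \<in> G"
      using sign_field_graph[of "odd_class 1" "odd_class 3" ?D, OF sq] odd_class_disjoint odd_class_Rats D
      by (metis finite_imageI finite_lessThan)
    obtain \<sigma> where s: "\<sigma> \<in> rat_galois_group (arboreal_field f)"
      and ext: "\<And>x y. (x, y) \<in> G \<Longrightarrow> x \<in> carrier (arboreal_field f) \<Longrightarrow> \<sigma> x = y"
      using galois_extension[OF G(1), of g c] unfolding f_def by blast
    obtain x where x: "x \<in> preimage_level f (n - 1)" using root by blast
    have "bij_betw (\<lambda>i. (\<sigma> ^^ i) x) {..<2 ^ (n - 1)} (preimage_level f (n - 1)) \<and> (\<sigma> ^^ 2 ^ (n - 1)) x = x"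
      unfolding f_def
    proof (rule transitive_orbit_if_discs_negated)
      fix j w assume "j < n - 1" "w \<in> carrier (arboreal_field (shifted_square g c))" "w\<^sup>2 = level_disc g c j"
      then show "\<sigma> w = - w" using ext G(2) unfolding f_def by blast
    qed (use s x crit in \<open>simp_all add: f_def\<close>)
    then have "acts_as_cycle (restrict \<sigma> (preimage_tree f)) (2 ^ (n - 1)) (preimage_level f (n - 1))"
      by (intro acts_as_cycleI[where x = x]) (simp_all add: pow[OF s x])
    then show ?thesis using s unfolding arboreal_galois_def by blast
  qed

  have no_cyc: "\<not> acts_as_cycle \<pi> (2 ^ n) (preimage_level f n)" if mem: "\<pi> \<in> arboreal_galois f" for \<pi>
  proof
    assume cyc: "acts_as_cycle \<pi> (2 ^ n) (preimage_level f n)"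
    obtain \<sigma> where s: "\<sigma> \<in> rat_galois_group (arboreal_field f)" and \<pi>: "\<pi> = restrict \<sigma> (preimage_tree f)"
      using mem unfolding arboreal_galois_def by blast
    obtain x where x: "x \<in> preimage_level f n" "inj_on (\<lambda>i. (\<pi> ^^ i) x) {..<2 ^ n}" "(\<pi> ^^ 2 ^ n) x = x"
      using acts_as_cycleE[OF cyc] by auto
    have "inj_on (\<lambda>i. (\<sigma> ^^ i) x) {..<2 ^ n}" "(\<sigma> ^^ 2 ^ n) x = x"
      using x(2,3) unfolding \<pi> pow[OF s x(1)] .
    \<comment> \<open>The sign \<open>(-1)^(2^(m + 1))\<close> is \<open>1\<close> because level \<open>m + 1\<close> has an even number of vertices.\<close>
    moreover have "level_disc g c (Suc m) = 1\<^sup>2" unfolding disc n by simp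
    ultimately show False
      using no_transitive_orbit_if_disc_square[of \<sigma> g c x "Suc m" 1] s crit x(1)
      unfolding f_def n by simp
  qed

  show ?thesis
  proof (intro exI[of _ f] conjI allI)
    show "Polynomial.degree f = 2" by (simp add: f_def shifted_square_def)
    show "no_critical_point f" using crit by (simp add: f_def tree_critical_point)
  qed (use trans cyc no_cyc in auto)
qed

end
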